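(* Let $\theta>0$ be a constant and let $p\in(0,1]$, $q\in[0,1)$ satisfy $\max\{p,1-q\}\geq\theta/n$. Let $G_0,G_1,\dots$ be an edge-Markovian evolving graph on $n$ vertices with parameters $p,q$ (arbitrary $G_0$), and let $\Gamma_0\in\mathbb{N}^V$ be any initial configuration with $\Delta\ge 1$. If the random matching algorithm satisfies the $F$-fair condition for some $0<F\le 1$, then there is a constant $c>0$ depending only on $\theta$ (e.g. $c=91/c_*$) such that for every $\varepsilon\in(0,1/4)$, \[\Pr\left[T_\mathrm{bal}\le \frac{c\, r\log\left(\frac{\Delta n}{\varepsilon}\right)}{F}\right]\ge 1-\varepsilon,\] where $r=\max\left\{\frac{p}{1-q},\frac{1-q}{p}\right\}\ge 1$.
   Context: Edge-Markovian evolving graph: $V$ is a fixed set of $n$ vertices; $G_t=(V,E_t)$ are simple undirected graphs, $G_0$ arbitrary, and $G_{t+1}$ is obtained from $G_t$ independently for each unordered pair $\{u,v\}$ of distinct vertices: a non-edge of $E_t$ becomes an edge of $E_{t+1}$ with probability $p$, an edge of $E_t$ is removed with probability $q$. $G_{t+1}$ depends only on $G_t$ (independent of the algorithm's random choices). Random matching algorithm: $\Gamma_t\in\mathbb{N}^V$ is the token configuration at time $t$, $K=\sum_v\Gamma_0(v)$, $\mu=K/n$, $\Delta=\max_v\Gamma_0(v)-\min_v\Gamma_0(v)$. At each time $t$ a random matching $M_t\subseteq E_t$ is drawn from a distribution that may depend on $G_t$ and on the history $(\Gamma_0,G_0,M_0),\dots,(\Gamma_{t-1},G_{t-1},M_{t-1}),\Gamma_t$.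 For each $\{v,u\}\in M_t$, with $s=\Gamma_t(v)+\Gamma_t(u)$, set $(\Gamma_{t+1}(v),\Gamma_{t+1}(u))$ equal to $(\lceil s/2\rceil,\lfloor s/2\rfloor)$ or $(\lfloor s/2\rfloor,\lceil s/2\rceil)$ with probability $1/2$ each; unmatched vertices keep their tokens. $F$-fair condition: for every $t$, every graph $G$ on $V$, every edge $\{u,v\}$ of $G$ and every event $\mathcal{E}$ (in particular any event about the history of the execution) with $\Pr[G_t=G,\mathcal{E}]>0$, $\Pr[\{u,v\}\in M_t\mid G_t=G,\mathcal{E}]\ge F/\max\{\deg_G(u),\deg_G(v)\}$. $\lceil x\rfloor:=\lceil x-1/2\rceil$; $T_\mathrm{bal}=\min\{t\ge0:\Gamma_t(v)\in\{\lceil\mu\rfloor-1,\lceil\mu\rfloor,\lceil\mu\rfloor+1\}\ \forall v\in V\}$. $c_*=\dfrac{(1-\exp(-\theta/3))^2}{2+1/\theta}$. Logarithms are natural. *)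

theory Defs
  imports "HOL-Probability.Probability"
begin

text \<open>
  The vertex set is a finite type \<open>'v\<close>, so \<open>n = CARD('v)\<close>. A graph is given by its edge set, and
  an edge is a two-element set of vertices.
\<close>

definition all_pairs :: "'v set set" where
  "all_pairs = {e. card e = 2}"

definition simple_graph :: "'v set set \<Rightarrow> bool" where
  "simple_graph E \<longleftrightarrow> E \<subseteq> all_pairs"

definition deg :: "'v set set \<Rightarrow> 'v \<Rightarrow> nat" where
  "deg E v = card {e \<in> E. v \<in> e}"

definition matching_in :: "'v set set \<Rightarrow> 'v set set \<Rightarrow> bool" where
  "matching_in E m \<longleftrightarrow> m \<subseteq> E \<and> pairwise disjnt m"

definition edge_markov_step :: "real \<Rightarrow> real \<Rightarrow> 'v::finite set set \<Rightarrow> 'v set set pmf" where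
  "edge_markov_step p q E =
     map_pmf (\<lambda>f. {e \<in> all_pairs. f e})
       (Pi_pmf all_pairs False (\<lambda>e. bernoulli_pmf (if e \<in> E then 1 - q else p)))"

text \<open>
  The coin of a matched edge is the endpoint that receives the larger half of its tokens.
  As \<open>m\<close> is a matching of two-element sets, the edge picked by the description operator is unique.
\<close>

definition balance_with :: "'v set set \<Rightarrow> ('v set \<Rightarrow> 'v) \<Rightarrow> ('v \<Rightarrow> nat) \<Rightarrow> 'v \<Rightarrow> nat" where
  "balance_with m coin \<gamma> v =
     (if v \<in> \<Union>m then
        (let e = (THE e. e \<in> m \<and> v \<in> e);
             s = (\<Sum>w\<in>e. \<gamma> w)
         in if coin e = v then nat \<lceil>real s / 2\<rceil> else nat \<lfloor>real s / 2\<rfloor>)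
      else \<gamma> v)"

definition balance_step :: "'v::finite set set \<Rightarrow> ('v \<Rightarrow> nat) \<Rightarrow> ('v \<Rightarrow> nat) pmf" where
  "balance_step m \<gamma> = map_pmf (\<lambda>coin. balance_with m coin \<gamma>) (Pi_pmf m undefined pmf_of_set)"

text \<open>
  Everything that happened strictly before \<open>G\<^sub>t\<close> and \<open>M\<^sub>t\<close> are drawn:
  \<open>(\<Gamma>\<^sub>0, G\<^sub>0, M\<^sub>0), \<dots>, (\<Gamma>\<^sub>t\<^sub>-\<^sub>1, G\<^sub>t\<^sub>-\<^sub>1, M\<^sub>t\<^sub>-\<^sub>1), \<Gamma>\<^sub>t\<close>.
\<close>

type_synonym 'v history = "(('v \<Rightarrow> nat) \<times> 'v set set \<times> 'v set set) list \<times> ('v \<Rightarrow> nat)"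

definition history ::
  "(nat \<Rightarrow> 'w \<Rightarrow> 'v set set) \<Rightarrow> (nat \<Rightarrow> 'w \<Rightarrow> 'v set set) \<Rightarrow> (nat \<Rightarrow> 'w \<Rightarrow> 'v \<Rightarrow> nat) \<Rightarrow>
   nat \<Rightarrow> 'w \<Rightarrow> 'v history" where
  "history G M \<Gamma> t \<omega> = (map (\<lambda>s. (\<Gamma> s \<omega>, G s \<omega>, M s \<omega>)) [0..<t], \<Gamma> t \<omega>)"

text \<open>
  An execution of a random matching algorithm on an edge-Markovian evolving graph. The law of
  \<open>G\<^sub>0\<close> and, apart from being supported on matchings of \<open>G\<^sub>t\<close>, the conditional law of \<open>M\<^sub>t\<close> given
  \<open>G\<^sub>t\<close> and the history are unconstrained.
\<close>

locale random_matching_execution = prob_space P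
  for P :: "'w measure" +
  fixes p q :: real
    and G M :: "nat \<Rightarrow> 'w \<Rightarrow> 'v::finite set set"
    and \<Gamma> :: "nat \<Rightarrow> 'w \<Rightarrow> 'v \<Rightarrow> nat"
    and \<gamma>\<^sub>0 :: "'v \<Rightarrow> nat"
  assumes measurable_G: "\<And>t. random_variable (count_space UNIV) (G t)"
    and measurable_M: "\<And>t. random_variable (count_space UNIV) (M t)"
    and measurable_\<Gamma>: "\<And>t. random_variable (count_space UNIV) (\<Gamma> t)"
    and initial_tokens: "AE \<omega> in P. \<Gamma> 0 \<omega> = \<gamma>\<^sub>0"
    and graph: "\<And>t. AE \<omega> in P. simple_graph (G t \<omega>)"
    and matching: "\<And>t. AE \<omega> in P. matching_in (G t \<omega>) (M t \<omega>)"
    and balancing: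
      "\<And>t m \<gamma> \<gamma>' A.
         \<P>(\<omega> in P. M t \<omega> = m \<and> \<Gamma> t \<omega> = \<gamma> \<and> (history G M \<Gamma> t \<omega>, G t \<omega>) \<in> A) > 0 \<Longrightarrow>
         \<P>(\<omega> in P. \<Gamma> (Suc t) \<omega> = \<gamma>' \<bar>
             M t \<omega> = m \<and> \<Gamma> t \<omega> = \<gamma> \<and> (history G M \<Gamma> t \<omega>, G t \<omega>) \<in> A)
           = pmf (balance_step m \<gamma>) \<gamma>'"
    and edge_markovian:
      "\<And>t E E' A.
         \<P>(\<omega> in P. G t \<omega> = E \<and> history G M \<Gamma> (Suc t) \<omega> \<in> A) > 0 \<Longrightarrow>
         \<P>(\<omega> in P. G (Suc t) \<omega> = E' \<bar> G t \<omega> = E \<and> history G M \<Gamma> (Suc t) \<omega> \<in> A)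
           = pmf (edge_markov_step p q E) E'"

text \<open>
  The conditioning events are those of the form \<open>G\<^sub>t = E\<close> intersected with an event about the
  history up to \<open>\<Gamma>\<^sub>t\<close>; events involving \<open>M\<^sub>t\<close> or the future have to be excluded, since conditioning
  on an edge not lying in \<open>M\<^sub>t\<close> would make the condition unsatisfiable.
\<close>

definition fair ::
  "'w measure \<Rightarrow> (nat \<Rightarrow> 'w \<Rightarrow> 'v set set) \<Rightarrow> (nat \<Rightarrow> 'w \<Rightarrow> 'v set set) \<Rightarrow>
   (nat \<Rightarrow> 'w \<Rightarrow> 'v \<Rightarrow> nat) \<Rightarrow> real \<Rightarrow> bool" where
  "fair P G M \<Gamma> F \<longleftrightarrow>
     (\<forall>t E u v A.
        simple_graph E \<longrightarrow> {u, v} \<in> E \<longrightarrow>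
        \<P>(\<omega> in P. G t \<omega> = E \<and> history G M \<Gamma> t \<omega> \<in> A) > 0 \<longrightarrow>
        \<P>(\<omega> in P. {u, v} \<in> M t \<omega> \<bar> G t \<omega> = E \<and> history G M \<Gamma> t \<omega> \<in> A)
          \<ge> F / real (max (deg E u) (deg E v)))"

definition mean_load :: "('v::finite \<Rightarrow> nat) \<Rightarrow> real" where
  "mean_load \<gamma> = real (\<Sum>v\<in>UNIV. \<gamma> v) / real CARD('v)"

definition discrepancy :: "('v::finite \<Rightarrow> nat) \<Rightarrow> nat" where
  "discrepancy \<gamma> = Max (range \<gamma>) - Min (range \<gamma>)"

text \<open>Rounding to the nearest integer, with ties rounded down.\<close>

definition round_half_down :: "real \<Rightarrow> int" where
  "round_half_down x = \<lceil>x - 1/2\<rceil>"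

definition balanced :: "real \<Rightarrow> ('v \<Rightarrow> nat) \<Rightarrow> bool" where
  "balanced \<mu> \<gamma> \<longleftrightarrow>
     (\<forall>v. int (\<gamma> v) \<in> {round_half_down \<mu> - 1, round_half_down \<mu>, round_half_down \<mu> + 1})"

text \<open>The balancing time is \<open>\<infinity>\<close> if no balanced configuration is ever reached.\<close>

definition T_bal :: "real \<Rightarrow> (nat \<Rightarrow> 'w \<Rightarrow> 'v \<Rightarrow> nat) \<Rightarrow> 'w \<Rightarrow> enat" where
  "T_bal \<mu> \<Gamma> \<omega> = Inf {enat t | t. balanced \<mu> (\<Gamma> t \<omega>)}"

definition c_star :: "real \<Rightarrow> real" where
  "c_star \<theta> = (1 - exp (- \<theta> / 3))\<^sup>2 / (2 + 1 / \<theta>)"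

end

theory Submission
  imports Defs
begin

text \<open>
  Let \<open>k\<close> be the rounded mean and \<open>y v = \<Gamma> v - k\<close>. The potential \<open>\<Sum>v. (y v)\<^sup>2 - \<bar>y v\<bar>\<close> is a nonnegative
  integer that vanishes exactly on balanced configurations, and averaging an edge lowers it by an
  amount that depends only on the two loads, not on the coin. Summed over all pairs of vertices these
  amounts are at least \<open>n / 32\<close> times the potential. From time 1 on, each pair is matched with
  probability at least \<open>\<beta> / n\<close>, \<open>\<beta> = F / (r (2 + 1 / \<theta>))\<close>, conditionally on the configuration: the pair is
  an edge with probability at least \<open>min p (1 - q)\<close>, and then the expected inverse of its larger degree
  is bounded below by convexity. Hence the expected potential shrinks by the factor \<open>1 - \<beta> / 32\<close> per
  step, and Markov's inequality concludes.
\<close>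

section \<open>The potential\<close>

text \<open>This is |y| (|y| - 1), which is convex on the integers and zero exactly at -1, 0 and 1,
  the deviations that a balanced configuration may have. A plain square could stay positive
  there.\<close>

definition excess :: "int \<Rightarrow> int" where
  "excess y = y\<^sup>2 - \<bar>y\<bar>"

text \<open>As \<open>div\<close> rounds towards minus infinity, the two quotients are the floor and
  the ceiling of the mean for negative deviations too.\<close>

definition gain :: "int \<Rightarrow> int \<Rightarrow> int" where
  "gain a b = excess a + excess b - excess ((a + b) div 2) - excess ((a + b + 1) div 2)"

lemma abs_le_square_int: "\<bar>y\<bar> \<le> y\<^sup>2" for y :: int
proof -
  have "\<bar>y\<bar> * 1 \<le> \<bar>y\<bar> * \<bar>y\<bar>" if "y \<noteq> 0"
    using that by (intro mult_left_mono) linarith+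
  thus ?thesis by (cases "y = 0") (simp_all add: power2_eq_square)
qed

lemma excess_nonneg: "excess y \<ge> 0"
  using abs_le_square_int[of y] by (simp add: excess_def)

lemma excess_le_square: "excess y \<le> y\<^sup>2"
  by (simp add: excess_def)

lemma excess_mono: "\<bar>y\<bar> \<le> d \<Longrightarrow> excess y \<le> d\<^sup>2"
  using excess_le_square[of y] abs_le_square_iff[of y d] by linarith

lemma excess_eq_0: "excess y = 0 \<Longrightarrow> y \<in> {-1, 0, 1}"
proof -
  assume "excess y = 0"
  hence "\<bar>y\<bar> * (\<bar>y\<bar> - 1) = 0" by (simp add: excess_def power2_eq_square algebra_simps)
  hence "\<bar>y\<bar> = 0 \<or> \<bar>y\<bar> = 1" by auto
  thus ?thesis by auto
qed

lemma gain_commute: "gain a b = gain b a"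
  by (simp add: gain_def add.commute)

text \<open>The two halves are \<open>h\<close> and \<open>h + r\<close> with \<open>r\<close> the
  parity bit. Twice the sum of their squares is (a + b)^2 + r. Being equal or consecutive, they
  never have strictly opposite signs, so their absolute values add up to |a + b|. Doubling avoids
  fractions.\<close>

lemma gain_eq:
  "2 * gain a b = (a - b)\<^sup>2 - (a + b) mod 2 - 2 * (\<bar>a\<bar> + \<bar>b\<bar> - \<bar>a + b\<bar>)"
proof -
  define h r where "h = (a + b) div 2" and "r = (a + b) mod 2"
  have s: "a + b = 2 * h + r" unfolding h_def r_def by simp
  have r: "r = 0 \<or> r = 1" unfolding r_def by auto
  have c: "(a + b + 1) div 2 = h + r" using s r by auto
  have b: "b = 2 * h + r - a" using s by simp
  have sq: "h\<^sup>2 + (h + r)\<^sup>2 + h\<^sup>2 + (h + r)\<^sup>2 = (a + b)\<^sup>2 + r"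
    using r unfolding s by (auto simp: power2_eq_square algebra_simps)
  have ab: "\<bar>h\<bar> + \<bar>h + r\<bar> = \<bar>a + b\<bar>"
    using r unfolding s by auto
  have "2 * gain a b = 2 * a\<^sup>2 + 2 * b\<^sup>2 - (h\<^sup>2 + (h + r)\<^sup>2 + h\<^sup>2 + (h + r)\<^sup>2)
          - 2 * (\<bar>a\<bar> + \<bar>b\<bar> - (\<bar>h\<bar> + \<bar>h + r\<bar>))"
    unfolding gain_def excess_def c h_def[symmetric] by simp
  also have "\<dots> = (a - b)\<^sup>2 - r - 2 * (\<bar>a\<bar> + \<bar>b\<bar> - \<bar>a + b\<bar>)"
    unfolding sq ab by (simp add: power2_eq_square algebra_simps)
  finally show ?thesis unfolding r_def .
qed

lemma gain_self: "gain a a = 0"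
  using gain_eq[of a a] by (simp add: abs_mult)

text \<open>Let \<open>m\<close> be the smaller absolute value and \<open>d\<close> the difference
  of the two. By \<open>gain_eq\<close> the right side is (2m + d)^2 - d mod 2 - 4m, and subtracting
  both excesses leaves the nonnegative terms 2 \<open>excess m\<close>, 2md and d - d mod 2.\<close>

lemma gain_opposite:
  assumes "0 \<le> a" "b \<le> 0"
  shows "excess a + excess b \<le> 2 * gain a b"
proof -
  have *: "excess m + excess (m + d) \<le> (2 * m + d)\<^sup>2 - d mod 2 - 4 * m"
    if "0 \<le> m" "0 \<le> d" for m d :: int
  proof -
    have "0 \<le> 2 * (excess m) + 2 * (m * d) + (d - d mod 2)"
      using that excess_nonneg[of m] zmod_le_nonneg_dividend[of d 2] by simp
    also have "\<dots> = (2 * m + d)\<^sup>2 - d mod 2 - 4 * m - (excess m + excess (m + d))"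
      using that by (simp add: excess_def power2_eq_square algebra_simps)
    finally show ?thesis by simp
  qed
  have ex: "excess b = excess (- b)" by (simp add: excess_def)
  show ?thesis
  proof (cases "a \<le> - b")
    case True
    have "(a + b) mod 2 = (- b - a) mod 2" by presburger
    thus ?thesis using *[of a "- b - a"] gain_eq[of a b] True assms ex by simp
  next
    case False
    have "(2 * - b + (a + b))\<^sup>2 = (a - b)\<^sup>2" by simp
    thus ?thesis using *[of "- b" "a + b"] gain_eq[of a b] False assms ex by simp
  qed
qed

text \<open>The sign correction in \<open>gain_eq\<close> is at most 2 |a - b|. After doubling, one
  of the two squares absorbs 4 |a - b| at the cost of 4, and the parity bit costs another 2.\<close>

lemma gain_ge_square: "(a - b)\<^sup>2 - 6 \<le> 4 * gain a b"
proof -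
  have "2 * (\<bar>a\<bar> + \<bar>b\<bar> - \<bar>a + b\<bar>) \<le> 2 * \<bar>a - b\<bar>"
    by (cases "0 \<le> a"; cases "0 \<le> b") auto
  moreover have "0 \<le> (\<bar>a - b\<bar> - 2)\<^sup>2" by simp
  hence "4 * \<bar>a - b\<bar> \<le> (a - b)\<^sup>2 + 4" by (simp add: power2_diff)
  moreover have "(a + b) mod 2 \<le> 1" by simp
  ultimately show ?thesis using gain_eq[of a b] by linarith
qed

text \<open>For equal signs the absolute values in \<open>gain_eq\<close> cancel, and the parity bit
  of a + b is that of a - b, hence at most (a - b)^2. Opposite signs fall under
  \<open>gain_opposite\<close>.\<close>

lemma gain_nonneg: "0 \<le> gain a b"
proof -
  consider "0 \<le> a" "0 \<le> b" | "a \<le> 0" "b \<le> 0" | "0 \<le> a" "b \<le> 0" | "a \<le> 0" "0 \<le> b"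
    by linarith
  thus ?thesis
  proof cases
    case 3
    thus ?thesis using gain_opposite[of a b] excess_nonneg[of a] excess_nonneg[of b] by simp
  next
    case 4
    thus ?thesis using gain_opposite[of b a] excess_nonneg[of a] excess_nonneg[of b]
      by (simp add: gain_commute)
  next
    have "(a + b) mod 2 = (a - b) mod 2" by presburger
    hence p: "(a + b) mod 2 \<le> (a - b)\<^sup>2"
      using abs_le_square_int[of "a - b"] by (cases "a = b") auto
    { case 1 thus ?thesis using gain_eq[of a b] p by simp }
    { case 2 thus ?thesis using gain_eq[of a b] p by simp }
  qed
qed

text \<open>Two regimes are needed, because \<open>gain_ge_square\<close> loses a constant per pair,
  which only a large second moment \<open>Q\<close> can pay for. For smaller \<open>Q\<close> the
  pairs of opposite sign carry the bound. The hypothesis on the sum of \<open>y\<close> limits the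
  loss in the first regime and forces both signs to be frequent in the second.\<close>

lemma drift_bound:
  fixes y :: "'v::finite \<Rightarrow> int"
  assumes bal: "2 * \<bar>\<Sum>v\<in>UNIV. y v\<bar> \<le> int CARD('v)"
  shows "int CARD('v) * (\<Sum>v\<in>UNIV. excess (y v)) \<le> 16 * (\<Sum>u\<in>UNIV. \<Sum>v\<in>UNIV. gain (y u) (y v))"
proof -
  define n where "n = int CARD('v)"
  define Q where "Q = (\<Sum>v\<in>UNIV. (y v)\<^sup>2)"
  define Y where "Y = (\<Sum>v\<in>UNIV. y v)"
  define \<Psi> where "\<Psi> = (\<Sum>v\<in>UNIV. excess (y v))"
  define S where "S = (\<Sum>u\<in>UNIV. \<Sum>v\<in>UNIV. gain (y u) (y v))"
  have n: "n > 0" by (simp add: n_def)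
  have Y: "2 * \<bar>Y\<bar> \<le> n" using bal by (simp add: n_def Y_def)
  have "\<Psi> \<le> Q" unfolding \<Psi>_def Q_def by (intro sum_mono excess_le_square)
  have "0 \<le> \<Psi>" unfolding \<Psi>_def by (intro sum_nonneg excess_nonneg)
  have "n * \<Psi> \<le> 16 * S"
  proof (cases "4 * n \<le> Q")
    case True
    \<comment> \<open>The variance of \<open>y\<close> outweighs the error terms of \<open>gain_ge_square\<close>.\<close>
    have "(\<Sum>u\<in>UNIV. \<Sum>v\<in>UNIV. (y u - y v)\<^sup>2 - 6)
        = (\<Sum>u\<in>UNIV. \<Sum>v\<in>UNIV. (y u)\<^sup>2 + (y v)\<^sup>2 - 2 * (y u * y v) - 6)"
      by (intro sum.cong) (auto simp: power2_eq_square algebra_simps)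
    also have "\<dots> = (\<Sum>u\<in>UNIV. n * (y u)\<^sup>2 + Q - 2 * y u * Y - 6 * n)"
      by (intro sum.cong)
        (auto simp: sum.distrib sum_subtractf n_def Q_def Y_def sum_distrib_left mult.assoc)
    also have "\<dots> = n * Q + n * Q - 2 * (Y * Y) - 6 * n * n"
      unfolding sum.distrib sum_subtractf
      by (simp add: n_def[symmetric] sum_distrib_left[symmetric] sum_distrib_right[symmetric]
          Q_def[symmetric] Y_def[symmetric])
    finally have "n * Q + n * Q - 2 * (Y * Y) - 6 * n * n
        = (\<Sum>u\<in>UNIV. \<Sum>v\<in>UNIV. (y u - y v)\<^sup>2 - 6)" ..
    also have "\<dots> \<le> (\<Sum>u\<in>UNIV. \<Sum>v\<in>UNIV. 4 * gain (y u) (y v))"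
      by (intro sum_mono gain_ge_square)
    also have "\<dots> = 4 * S" by (simp add: S_def sum_distrib_left)
    finally have *: "2 * (n * Q) - 2 * (Y * Y) - 6 * (n * n) \<le> 4 * S" by (simp add: mult.commute mult.assoc)
    have "(2 * \<bar>Y\<bar>) * (2 * \<bar>Y\<bar>) \<le> n * n" using Y by (intro mult_mono) auto
    hence YY: "4 * (Y * Y) \<le> n * n" by simp
    have "n * (4 * n) \<le> n * Q" using True n by (intro mult_left_mono) auto
    moreover have "n * \<Psi> \<le> n * Q" using \<open>\<Psi> \<le> Q\<close> n by (intro mult_left_mono) auto
    \<comment> \<open>Since Y^2 <= n^2 / 4 and n^2 <= n Q / 4, the bound gives 4 S >= 2 n Q - 13 n^2
      / 2 >= 3 n Q / 8, while n Q / 4 suffices.\<close>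
    ultimately show ?thesis using * YY zero_le_square[of n] by linarith
  next
    case False
    \<comment> \<open>At least \<open>n / 16\<close> vertices have \<open>y \<le> 0\<close>, and as many have \<open>y \<ge> 0\<close>: every vertex has that many
      partners of opposite sign. The count comes from \<open>y\<^sup>2 + 14 y \<ge> 15 - 64 [y \<le> 0]\<close>.\<close>
    have cnt: "n \<le> 16 * (\<Sum>v\<in>UNIV. if 0 \<le> - s * y v then 1 else 0)" if s: "s = 1 \<or> s = -1" for s :: int
    proof -
      have "(\<Sum>v\<in>UNIV. 15 - 64 * (if 0 \<le> - s * y v then 1 else 0))
          \<le> (\<Sum>v\<in>UNIV. (y v)\<^sup>2 + 14 * s * y v)"
      proof (rule sum_mono)
        fix v
        define z where "z = s * y v"
        have z2: "(y v)\<^sup>2 = z\<^sup>2" using s by (auto simp: z_def)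
        show "15 - 64 * (if 0 \<le> - s * y v then 1 else 0) \<le> (y v)\<^sup>2 + 14 * s * y v"
        \<comment> \<open>The minimum of z^2 + 14 z over all z is -49 = 15 - 64, at z = -7; over the
          positive integers it is 15, at z = 1.\<close>
        proof (cases "0 \<le> - z")
          case True
          have "0 \<le> (z + 7)\<^sup>2" by simp
          hence "- 49 \<le> z\<^sup>2 + 14 * z" by (simp add: power2_eq_square algebra_simps)
          thus ?thesis using True by (simp add: z2 z_def[symmetric] mult.assoc)
        next
          case False
          hence "1 * 1 \<le> z * z" by (intro mult_mono) auto
          hence "15 \<le> z\<^sup>2 + 14 * z" using False by (simp add: power2_eq_square)
          thus ?thesis using False by (simp add: z2 z_def[symmetric] mult.assoc)
        qed
      qed
      hence "15 * n - 64 * (\<Sum>v\<in>UNIV. if 0 \<le> - s * y v then 1 else 0) \<le> Q + 14 * s * Y"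
        unfolding sum.distrib sum_subtractf
        by (simp add: n_def[symmetric] sum_distrib_left[symmetric] Q_def[symmetric] Y_def[symmetric])
      \<comment> \<open>With \<open>Q < 4 * n\<close>, 64 times the count is at least 15 n - 4 n - 7
        n = 4 n.\<close>
      moreover have "14 * s * Y \<le> 7 * n" using s Y by auto
      ultimately show ?thesis using False by linarith
    qed
    define opp where "opp = (\<lambda>u v. 0 \<le> y u \<and> y v \<le> 0 \<or> y u \<le> 0 \<and> 0 \<le> y v)"
    define W where "W = (\<Sum>u\<in>UNIV. \<Sum>v\<in>UNIV. if opp u v then excess (y u) else 0)"
    \<comment> \<open>Symmetrised form of \<open>W\<close>: swapping the summation variables turns
      the second summand into the first, so the left side is 2 W.\<close>
    have "(\<Sum>u\<in>UNIV. \<Sum>v\<in>UNIV. (if opp u v then excess (y u) else 0)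
            + (if opp v u then excess (y v) else 0))
        \<le> (\<Sum>u\<in>UNIV. \<Sum>v\<in>UNIV. 2 * gain (y u) (y v))"
    proof (intro sum_mono)
      fix u v
      show "(if opp u v then excess (y u) else 0) + (if opp v u then excess (y v) else 0)
          \<le> 2 * gain (y u) (y v)"
        using gain_opposite[of "y u" "y v"] gain_opposite[of "y v" "y u"]
          gain_nonneg[of "y u" "y v"] gain_commute[of "y u" "y v"]
        by (auto simp: opp_def)
    qed
    also have "\<dots> = 2 * S" by (simp add: S_def sum_distrib_left)
    also have "(\<Sum>u\<in>UNIV. \<Sum>v\<in>UNIV. (if opp u v then excess (y u) else 0)
            + (if opp v u then excess (y v) else 0)) = W + W"
      unfolding sum.distrib W_def
      by (simp add: sum.swap[of "\<lambda>u v. if opp v u then excess (y v) else 0"])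
    finally have WS: "W \<le> S" by simp
    have "n * \<Psi> = (\<Sum>u\<in>UNIV. n * excess (y u))" by (simp add: \<Psi>_def sum_distrib_left)
    also have "\<dots> \<le> (\<Sum>u\<in>UNIV. 16 * (\<Sum>v\<in>UNIV. if opp u v then excess (y u) else 0))"
    proof (intro sum_mono)
      fix u
      \<comment> \<open>With this sign, every vertex counted by \<open>cnt\<close> has a deviation
        opposite to that of \<open>u\<close>, so \<open>u\<close> has at least n / 16
        partners.\<close>
      obtain s :: int where s: "s = 1 \<or> s = -1" "0 \<le> s * y u"
        by (cases "0 \<le> y u") (auto intro: that[of 1] that[of "-1"])
      have "n * excess (y u) \<le> 16 * (\<Sum>v\<in>UNIV. if 0 \<le> - s * y v then 1 else 0) * excess (y u)"
        using cnt[OF s(1)] excess_nonneg by (intro mult_right_mono) auto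
      also have "\<dots> = 16 * (\<Sum>v\<in>UNIV. if 0 \<le> - s * y v then excess (y u) else 0)"
        unfolding mult.assoc sum_distrib_right by (auto intro: sum.cong)
      also have "\<dots> \<le> 16 * (\<Sum>v\<in>UNIV. if opp u v then excess (y u) else 0)"
        using s excess_nonneg[of "y u"]
        by (intro mult_left_mono sum_mono) (auto simp: opp_def)
      finally show "n * excess (y u) \<le> 16 * (\<Sum>v\<in>UNIV. if opp u v then excess (y u) else 0)" .
    qed
    also have "\<dots> = 16 * W" by (simp add: W_def sum_distrib_left)
    finally show ?thesis using WS by simp
  qed
  thus ?thesis by (simp add: n_def \<Psi>_def S_def)
qed

section \<open>Potential of a token configuration\<close>

definition potential :: "int \<Rightarrow> ('v::finite \<Rightarrow> nat) \<Rightarrow> int" where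
  "potential k \<gamma> = (\<Sum>v\<in>UNIV. excess (int (\<gamma> v) - k))"

text \<open>The counterpart of \<open>gain\<close> for an unordered edge, so that it can be summed
  over a matching. Halving takes place on the token counts, before the shift by \<open>k\<close>, as
  in the balancing rule.\<close>

definition edge_gain :: "int \<Rightarrow> ('v \<Rightarrow> nat) \<Rightarrow> 'v set \<Rightarrow> int" where
  "edge_gain k \<gamma> e = (\<Sum>w\<in>e. excess (int (\<gamma> w) - k))
     - excess (int ((\<Sum>w\<in>e. \<gamma> w) div 2) - k) - excess (int (((\<Sum>w\<in>e. \<gamma> w) + 1) div 2) - k)"

lemma edge_gain_pair:
  assumes "u \<noteq> v"
  shows "edge_gain k \<gamma> {u, v} = gain (int (\<gamma> u) - k) (int (\<gamma> v) - k)"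
proof -
  have "int ((\<gamma> u + \<gamma> v) div 2) - k = (int (\<gamma> u) - k + (int (\<gamma> v) - k)) div 2"
    "int ((\<gamma> u + \<gamma> v + 1) div 2) - k = (int (\<gamma> u) - k + (int (\<gamma> v) - k) + 1) div 2"
    by linarith+
  thus ?thesis using assms by (simp add: edge_gain_def gain_def)
qed

lemma edge_gain_nonneg: "e \<in> all_pairs \<Longrightarrow> 0 \<le> edge_gain k \<gamma> e"
  by (auto simp: all_pairs_def card_2_iff edge_gain_pair gain_nonneg)

lemma potential_nonneg: "0 \<le> potential k \<gamma>"
  unfolding potential_def by (intro sum_nonneg excess_nonneg)

text \<open>The map from off-diagonal ordered pairs to edges has fibres of size two.\<close>

lemma sum_ordered_pairs:
  fixes f :: "'v::finite \<Rightarrow> 'v \<Rightarrow> int"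
  assumes diag: "\<And>u. f u u = 0" and g: "\<And>u v. u \<noteq> v \<Longrightarrow> f u v = g {u, v}"
  shows "(\<Sum>u\<in>UNIV. \<Sum>v\<in>UNIV. f u v) = 2 * (\<Sum>e\<in>all_pairs. g e)"
proof -
  define h :: "'v \<times> 'v \<Rightarrow> 'v set" where "h = (\<lambda>(u, v). {u, v})"
  define D where "D = {(u, v). u \<noteq> (v :: 'v)}"
  have "(\<Sum>u\<in>UNIV. \<Sum>v\<in>UNIV. f u v) = (\<Sum>(u, v)\<in>UNIV. f u v)"
    by (simp add: sum.cartesian_product)
  also have "\<dots> = (\<Sum>(u, v)\<in>D. f u v)"
    by (rule sum.mono_neutral_right) (auto simp: D_def diag)
  also have "\<dots> = (\<Sum>x\<in>D. g (h x))"
    by (intro sum.cong) (auto simp: D_def g h_def)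
  also have "\<dots> = (\<Sum>e\<in>h ` D. \<Sum>x\<in>{x \<in> D. h x = e}. g (h x))"
    by (rule sum.image_gen) simp
  also have "h ` D = all_pairs"
    by (auto simp: h_def D_def all_pairs_def card_2_iff image_iff)
  also have "(\<Sum>e\<in>all_pairs. \<Sum>x\<in>{x \<in> D. h x = e}. g (h x)) = (\<Sum>e\<in>all_pairs. 2 * g e)"
  proof (intro sum.cong refl)
    fix e :: "'v set" assume "e \<in> all_pairs"
    then obtain a b where e: "e = {a, b}" "a \<noteq> b" by (auto simp: all_pairs_def card_2_iff)
    have "{x \<in> D. h x = e} = {(a, b), (b, a)}"
      using e by (auto simp: D_def h_def doubleton_eq_iff)
    thus "(\<Sum>x\<in>{x \<in> D. h x = e}. g (h x)) = 2 * g e"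
      using e by (simp add: h_def insert_commute)
  qed
  finally show ?thesis by (simp add: sum_distrib_left)
qed

lemma potential_le_edge_gain:
  fixes \<gamma> :: "'v::finite \<Rightarrow> nat"
  assumes "2 * \<bar>int (\<Sum>v\<in>UNIV. \<gamma> v) - int CARD('v) * k\<bar> \<le> int CARD('v)"
  shows "int CARD('v) * potential k \<gamma> \<le> 32 * (\<Sum>e\<in>all_pairs. edge_gain k \<gamma> e)"
proof -
  have "(\<Sum>v\<in>UNIV. int (\<gamma> v) - k) = int (\<Sum>v\<in>UNIV. \<gamma> v) - int CARD('v) * k"
    by (simp add: sum_subtractf)
  moreover have "(\<Sum>u\<in>UNIV. \<Sum>v\<in>UNIV. gain (int (\<gamma> u) - k) (int (\<gamma> v) - k))
      = 2 * (\<Sum>e\<in>all_pairs. edge_gain k \<gamma> e)"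
    by (rule sum_ordered_pairs) (simp_all add: gain_self edge_gain_pair)
  ultimately show ?thesis
    using drift_bound[of "\<lambda>v. int (\<gamma> v) - k"] assms by (simp add: potential_def)
qed

section \<open>Effect of one balancing step\<close>

text \<open>Matched edges are disjoint and all other vertices keep their tokens, so the sum splits
  edge by edge. With \<open>h = int\<close> this yields conservation of tokens, with the shifted
  excess the loss of potential.\<close>

lemma sum_balance_with:
  fixes \<gamma> :: "'v::finite \<Rightarrow> nat" and h :: "nat \<Rightarrow> 'a::ab_group_add"
  assumes E: "simple_graph E" and m: "matching_in E m" and coin: "\<And>e. e \<in> m \<Longrightarrow> coin e \<in> e"
  shows "(\<Sum>v\<in>UNIV. h (balance_with m coin \<gamma> v)) = (\<Sum>v\<in>UNIV. h (\<gamma> v))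
    - (\<Sum>e\<in>m. (\<Sum>w\<in>e. h (\<gamma> w)) - h ((\<Sum>w\<in>e. \<gamma> w) div 2) - h (((\<Sum>w\<in>e. \<gamma> w) + 1) div 2))"
proof -
  have disj: "e = e'" if "e \<in> m" "e' \<in> m" "v \<in> e" "v \<in> e'" for e e' v
    using m that by (auto simp: matching_in_def pairwise_def disjnt_def)
  have pair: "card e = 2" if "e \<in> m" for e
    using that E m by (auto simp: simple_graph_def matching_in_def all_pairs_def)
  have split: "(\<Sum>v\<in>UNIV. F v) = (\<Sum>v\<in>- \<Union>m. F v) + (\<Sum>e\<in>m. \<Sum>v\<in>e. F v)" for F :: "'v \<Rightarrow> 'a"
  proof -
    have "(\<Sum>v\<in>UNIV. F v) = (\<Sum>v\<in>- \<Union>m. F v) + (\<Sum>v\<in>\<Union>m. F v)"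
      by (subst sum.union_disjoint[symmetric]) (auto intro: sum.cong)
    also have "(\<Sum>v\<in>\<Union>m. F v) = (\<Sum>e\<in>m. \<Sum>v\<in>e. F v)"
      using disj by (subst sum.Union_disjoint) (auto simp: o_def)
    finally show ?thesis .
  qed
  have edge: "(\<Sum>v\<in>e. h (balance_with m coin \<gamma> v))
      = h ((\<Sum>w\<in>e. \<gamma> w) div 2) + h (((\<Sum>w\<in>e. \<gamma> w) + 1) div 2)" if e: "e \<in> m" for e
  proof -
    define s where "s = (\<Sum>w\<in>e. \<gamma> w)"
    from pair[OF e] coin[OF e] obtain w where w: "e = {coin e, w}" "w \<noteq> coin e"
      by (force simp: card_2_iff insert_commute)
    have bw: "balance_with m coin \<gamma> v = (if coin e = v then (s + 1) div 2 else s div 2)"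
      if "v \<in> e" for v
    proof -
      have "(THE e. e \<in> m \<and> v \<in> e) = e"
        using disj e that by (intro the_equality) blast+
      moreover have "nat \<lceil>real s / 2\<rceil> = (s + 1) div 2" by linarith
      moreover have "nat \<lfloor>real s / 2\<rfloor> = s div 2" by linarith
      ultimately show ?thesis
        using that e by (auto simp: balance_with_def Let_def s_def)
    qed
    have "(\<Sum>v\<in>e. h (balance_with m coin \<gamma> v))
        = (\<Sum>v\<in>e. h (if coin e = v then (s + 1) div 2 else s div 2))"
      by (intro sum.cong) (simp_all add: bw)
    also have "\<dots> = (\<Sum>v\<in>{coin e, w}. h (if coin e = v then (s + 1) div 2 else s div 2))"
      using w(1) by simp
    also have "\<dots> = h (s div 2) + h ((s + 1) div 2)"
      using w(2) by simp
    finally show ?thesis by (simp add: s_def)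
  qed
  have "(\<Sum>v\<in>- \<Union>m. h (balance_with m coin \<gamma> v)) = (\<Sum>v\<in>- \<Union>m. h (\<gamma> v))"
    by (intro sum.cong) (auto simp: balance_with_def)
  thus ?thesis
    unfolding split by (simp add: edge sum_subtractf sum.distrib)
qed

text \<open>A coin only decides which endpoint receives the larger half, so both identities hold for
  every outcome in the support and not just on average.\<close>

lemma set_balance_step:
  fixes \<gamma> :: "'v::finite \<Rightarrow> nat"
  assumes E: "simple_graph E" and m: "matching_in E m" and \<gamma>': "\<gamma>' \<in> set_pmf (balance_step m \<gamma>)"
  shows "(\<Sum>v\<in>UNIV. \<gamma>' v) = (\<Sum>v\<in>UNIV. \<gamma> v)"
    and "potential k \<gamma>' = potential k \<gamma> - (\<Sum>e\<in>m. edge_gain k \<gamma> e)"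
proof -
  have fin: "finite m" by simp
  from \<gamma>' obtain coin where coin: "coin \<in> set_pmf (Pi_pmf m undefined pmf_of_set)"
    and \<gamma>'_eq: "\<gamma>' = balance_with m coin \<gamma>"
    by (auto simp: balance_step_def)
  have "coin e \<in> e" if "e \<in> m" for e
  proof -
    have "e \<noteq> {}"
      using that E m by (auto simp: simple_graph_def matching_in_def all_pairs_def)
    hence "set_pmf (pmf_of_set e) = e" by (intro set_pmf_of_set) auto
    moreover have "coin e \<in> set_pmf (pmf_of_set e)"
      using coin that by (auto simp: set_Pi_pmf[OF fin] PiE_dflt_def)
    ultimately show ?thesis by simp
  qed
  note * = sum_balance_with[OF E m this]
  have "int (\<Sum>v\<in>UNIV. \<gamma>' v) = int (\<Sum>v\<in>UNIV. \<gamma> v)"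
  proof -
    have "int a - int (a div 2) - int ((a + 1) div 2) = 0" for a by linarith
    thus ?thesis
      using *[where h = int and \<gamma> = \<gamma>] by (simp add: \<gamma>'_eq flip: of_nat_sum)
  qed
  thus "(\<Sum>v\<in>UNIV. \<gamma>' v) = (\<Sum>v\<in>UNIV. \<gamma> v)" by (simp only: of_nat_eq_iff)
  show "potential k \<gamma>' = potential k \<gamma> - (\<Sum>e\<in>m. edge_gain k \<gamma> e)"
    using *[where h = "\<lambda>x. excess (int x - k)" and \<gamma> = \<gamma>]
    by (simp add: \<gamma>'_eq potential_def edge_gain_def)
qed

section \<open>Edge probabilities\<close>

context
  fixes p q :: real
  assumes pq: "0 < p" "p \<le> 1" "0 \<le> q" "q < 1"
begin

definition edge_prob :: "'v set set \<Rightarrow> 'v set \<Rightarrow> real" where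
  "edge_prob E e = (if e \<in> E then 1 - q else p)"

text \<open>The event is a product set, with the pairs of \<open>S\<close> forced to be present and
  all others free, so independence factorises its probability.\<close>

lemma prob_edges_present:
  fixes E :: "'v::finite set set"
  assumes "S \<subseteq> all_pairs"
  shows "measure_pmf.prob (edge_markov_step p q E) {E'. S \<subseteq> E'} = (\<Prod>e\<in>S. edge_prob E e)"
proof -
  let ?D = "\<lambda>e. bernoulli_pmf (if e \<in> E then 1 - q else p)"
  let ?B = "\<lambda>e. if e \<in> S then {True} else UNIV"
  have "measure_pmf.prob (edge_markov_step p q E) {E'. S \<subseteq> E'}
      = measure_pmf.prob (Pi_pmf all_pairs False ?D) (Pi all_pairs ?B)"
    unfolding edge_markov_step_def measure_map_pmf
    using assms by (intro arg_cong[where f = "measure_pmf.prob _"]) (force simp: Pi_iff split: if_splits)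
  also have "\<dots> = (\<Prod>e\<in>all_pairs. measure_pmf.prob (?D e) (?B e))"
    by (rule measure_Pi_pmf_Pi) simp
  also have "\<dots> = (\<Prod>e\<in>all_pairs. if e \<in> S then edge_prob E e else 1)"
    using pq by (intro prod.cong) (auto simp: measure_pmf_single edge_prob_def)
  also have "\<dots> = (\<Prod>e\<in>S. edge_prob E e)"
    using assms by (simp add: prod.If_cases Int_absorb1)
  finally show ?thesis .
qed

lemma edge_markov_step_subset: "E' \<in> set_pmf (edge_markov_step p q E) \<Longrightarrow> E' \<subseteq> all_pairs"
  by (auto simp: edge_markov_step_def)

text \<open>Every edge at either endpoint is \<open>{u, v}\<close> itself or one of the adjacent
  edges counted on the right. Counting both endpoints together makes the bound linear in the edge
  indicators.\<close>

lemma max_deg_le: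
  fixes E :: "'v::finite set set"
  assumes "{u, v} \<in> E"
  shows "max (deg E u) (deg E v) \<le> 1 + card {f \<in> E. f \<noteq> {u, v} \<and> f \<inter> {u, v} \<noteq> {}}"
proof -
  let ?N = "{f \<in> E. f \<noteq> {u, v} \<and> f \<inter> {u, v} \<noteq> {}}"
  have "deg E w \<le> card (insert {u, v} ?N)" if "w \<in> {u, v}" for w
    unfolding deg_def using that by (intro card_mono) auto
  thus ?thesis by (simp add: card_insert_if)
qed

lemma card_adjacent_pairs_le:
  fixes u v :: "'v::finite"
  shows "card {f \<in> all_pairs. f \<noteq> {u, v} \<and> f \<inter> {u, v} \<noteq> {}} \<le> 2 * CARD('v)"
proof -
  have "{f \<in> all_pairs. f \<noteq> {u, v} \<and> f \<inter> {u, v} \<noteq> {}} \<subseteq> range (\<lambda>w. {u, w}) \<union> range (\<lambda>w. {v, w})"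
    by (auto simp: all_pairs_def card_2_iff insert_commute)
  hence "card {f \<in> all_pairs. f \<noteq> {u, v} \<and> f \<inter> {u, v} \<noteq> {}}
      \<le> card (range (\<lambda>w. {u, w}) \<union> range (\<lambda>w. {v, w}))"
    by (intro card_mono) auto
  also have "\<dots> \<le> card (range (\<lambda>w. {u, w})) + card (range (\<lambda>w. {v, w}))"
    by (rule card_Un_le)
  also have "\<dots> \<le> CARD('v) + CARD('v)"
    by (intro add_mono card_image_le) auto
  finally show ?thesis by simp
qed

text \<open>
  The convex function \<open>1/z\<close> is replaced by its tangent at \<open>c\<close>; the resulting expression is linear in
  the edge indicators, so that only the joint presence of pairs of edges matters.
\<close>

lemma expected_inverse_max_deg:
  fixes E :: "'v::finite set set"
  assumes uv: "u \<noteq> v"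
  defines "c \<equiv> 1 + 2 * real CARD('v) * max p (1 - q)"
  shows "(\<Sum>E'\<in>{E'. {u, v} \<in> E'}. pmf (edge_markov_step p q E) E' / real (max (deg E' u) (deg E' v)))
    \<ge> min p (1 - q) / c"
proof -
  define e where "e = {u, v}"
  define N where "N = {f \<in> all_pairs. f \<noteq> e \<and> f \<inter> e \<noteq> {}}"
  define D where "D = edge_markov_step p q E"
  have e: "e \<in> all_pairs" using uv by (simp add: e_def all_pairs_def)
  have "0 \<le> 2 * real CARD('v) * max p (1 - q)" using pq by auto
  hence c: "c > 0" unfolding c_def by linarith
  have ep: "min p (1 - q) \<le> edge_prob E f" "edge_prob E f \<le> max p (1 - q)" for f
    by (auto simp: edge_prob_def)
  have sum_pmf: "(\<Sum>E'\<in>{E'. S \<subseteq> E'}. pmf D E') = (\<Prod>f\<in>S. edge_prob E f)" if "S \<subseteq> all_pairs" for S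
    using prob_edges_present[OF that] by (simp add: measure_measure_pmf_finite D_def)
  have tangent: "2 / c - z / c\<^sup>2 \<le> 1 / z" if "z > 0" for z
  proof -
    have "2 / c - z / c\<^sup>2 = 1 / z - (z - c)\<^sup>2 / (z * c\<^sup>2)"
      using c that by (simp add: field_simps power2_eq_square)
    thus ?thesis using that by simp
  qed
  have "(\<Sum>E'\<in>{E'. e \<in> E'}. pmf D E' * (2 / c - 1 / c\<^sup>2) - (\<Sum>f\<in>N. (if f \<in> E' then pmf D E' else 0)) / c\<^sup>2)
      \<le> (\<Sum>E'\<in>{E'. e \<in> E'}. pmf D E' / real (max (deg E' u) (deg E' v)))"
  proof (rule sum_mono)
    fix E' assume "E' \<in> {E'. e \<in> E'}"
    hence eE: "{u, v} \<in> E'" by (simp add: e_def)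
    show "pmf D E' * (2 / c - 1 / c\<^sup>2) - (\<Sum>f\<in>N. (if f \<in> E' then pmf D E' else 0)) / c\<^sup>2
        \<le> pmf D E' / real (max (deg E' u) (deg E' v))"
    \<comment> \<open>The degree estimate in terms of \<open>N\<close> requires \<open>E'\<close> to
      consist of pairs, which is known on the support; off the support both sides vanish.\<close>
    proof (cases "E' \<in> set_pmf D")
      case True
      define z where "z = real (max (deg E' u) (deg E' v))"
      define s where "s = real (card (N \<inter> E'))"
      have "deg E' u > 0"
        unfolding deg_def using eE by (subst card_gt_0_iff) auto
      hence z: "z > 0" unfolding z_def by simp
      have "E' \<subseteq> all_pairs" using True edge_markov_step_subset by (auto simp: D_def)
      hence "N \<inter> E' = {f \<in> E'. f \<noteq> {u, v} \<and> f \<inter> {u, v} \<noteq> {}}"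
        by (auto simp: N_def e_def)
      hence "max (deg E' u) (deg E' v) \<le> 1 + card (N \<inter> E')"
        using max_deg_le[OF eE] by simp
      hence "z \<le> 1 + s" unfolding z_def s_def by linarith
      hence "z / c\<^sup>2 \<le> (1 + s) / c\<^sup>2" using c by (intro divide_right_mono) auto
      with tangent[OF z] have "2 / c - (1 + s) / c\<^sup>2 \<le> 1 / z" by linarith
      hence "pmf D E' * (2 / c - (1 + s) / c\<^sup>2) \<le> pmf D E' * (1 / z)"
        by (intro mult_left_mono) auto
      moreover have "(\<Sum>f\<in>N. (if f \<in> E' then pmf D E' else 0)) = s * pmf D E'"
        by (simp add: s_def sum.If_cases Int_def)
      ultimately show ?thesis
        by (simp add: z_def[symmetric] algebra_simps add_divide_distrib)
    next
      case False
      hence "pmf D E' = 0" by (simp add: set_pmf_iff)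
      thus ?thesis by (auto simp: sum_nonneg)
    qed
  qed
  also have "(\<Sum>E'\<in>{E'. e \<in> E'}. pmf D E' * (2 / c - 1 / c\<^sup>2) - (\<Sum>f\<in>N. (if f \<in> E' then pmf D E' else 0)) / c\<^sup>2)
      = edge_prob E e * (2 / c - 1 / c\<^sup>2) - (\<Sum>f\<in>N. edge_prob E e * edge_prob E f) / c\<^sup>2"
  proof -
    have "(\<Sum>E'\<in>{E'. e \<in> E'}. pmf D E') = edge_prob E e"
      using sum_pmf[of "{e}"] e by simp
    moreover have "(\<Sum>E'\<in>{E'. e \<in> E'}. \<Sum>f\<in>N. (if f \<in> E' then pmf D E' else 0))
        = (\<Sum>f\<in>N. edge_prob E e * edge_prob E f)"
    proof (subst sum.swap, intro sum.cong refl)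
      fix f assume f: "f \<in> N"
      have "(\<Sum>E'\<in>{E'. e \<in> E'}. if f \<in> E' then pmf D E' else 0) = (\<Sum>E'\<in>{E'. {e, f} \<subseteq> E'}. pmf D E')"
        by (intro sum.mono_neutral_cong_right) auto
      also have "\<dots> = edge_prob E e * edge_prob E f"
      proof -
        have "e \<noteq> f" "{e, f} \<subseteq> all_pairs" using f e by (auto simp: N_def)
        thus ?thesis using sum_pmf[of "{e, f}"] by simp
      qed
      finally show "(\<Sum>E'\<in>{E'. e \<in> E'}. if f \<in> E' then pmf D E' else 0) = edge_prob E e * edge_prob E f" .
    qed
    ultimately show ?thesis
      by (simp only: sum_subtractf sum_divide_distrib[symmetric] sum_distrib_right[symmetric])
  qed
  also have "\<dots> = edge_prob E e * (2 / c - (1 + (\<Sum>f\<in>N. edge_prob E f)) / c\<^sup>2)"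
    unfolding sum_distrib_left[symmetric] by (simp add: algebra_simps add_divide_distrib)
  also have "\<dots> \<ge> edge_prob E e * (1 / c)"
  proof (rule mult_left_mono)
    \<comment> \<open>The tangent point \<open>c\<close> bounds 1 plus the expected number of
      adjacent edges, so the bracket is at least 2 / c - c / c^2 = 1 / c.\<close>
    have "(\<Sum>f\<in>N. edge_prob E f) \<le> real (card N) * max p (1 - q)"
      by (intro sum_bounded_above ep)
    also have "\<dots> \<le> (2 * real CARD('v)) * max p (1 - q)"
      using card_adjacent_pairs_le[of u v] pq
      by (intro mult_right_mono) (auto simp: N_def e_def)
    finally have "1 + (\<Sum>f\<in>N. edge_prob E f) \<le> c" unfolding c_def by simp
    hence "(1 + (\<Sum>f\<in>N. edge_prob E f)) / c\<^sup>2 \<le> c / c\<^sup>2" by (intro divide_right_mono) auto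
    also have "c / c\<^sup>2 = 1 / c" by (simp add: power2_eq_square)
    finally show "1 / c \<le> 2 / c - (1 + (\<Sum>f\<in>N. edge_prob E f)) / c\<^sup>2" by simp
    show "0 \<le> edge_prob E e" using pq by (auto simp: edge_prob_def)
  qed
  moreover have "edge_prob E e * (1 / c) \<ge> min p (1 - q) * (1 / c)"
    using ep c by (intro mult_right_mono) auto
  ultimately show ?thesis by (simp add: D_def e_def)
qed

end

lemma max_ratio:
  fixes a b :: real
  assumes "0 < a" "0 < b"
  shows "max (a / b) (b / a) = max a b / min a b"
proof (cases "a \<le> b")
  case True
  hence "a / b \<le> b / a" using assms by (simp add: field_simps mult_mono)
  thus ?thesis using True by (simp add: max_def)
next
  case False
  hence "b / a \<le> a / b" using assms by (simp add: field_simps mult_mono)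
  thus ?thesis using False by (auto simp: max_def min_def)
qed

text \<open>The density assumption gives 1 <= n b / \<theta> for b = \<open>max p (1 - q)\<close>.
  This absorbs the additive 1 into n b (2 + 1 / \<theta>), and the remaining quotient of minimum by
  maximum is 1 / r by \<open>max_ratio\<close>.\<close>

lemma matched_rate:
  fixes \<theta> p q n :: real
  assumes "0 < \<theta>" "0 < p" "q < 1" "0 < n" "\<theta> / n \<le> max p (1 - q)"
  shows "1 / (max (p / (1 - q)) ((1 - q) / p) * (2 + 1 / \<theta>)) / n
    \<le> min p (1 - q) / (1 + 2 * n * max p (1 - q))"
proof -
  define a b where "a = min p (1 - q)" and "b = max p (1 - q)"
  have a: "0 < a" and b: "0 < b" using assms by (auto simp: a_def b_def)
  have "1 \<le> n * b / \<theta>" using assms by (simp add: b_def field_simps)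
  hence "1 + 2 * n * b \<le> n * b * (2 + 1 / \<theta>)" by (simp add: algebra_simps)
  hence "a / (n * b * (2 + 1 / \<theta>)) \<le> a / (1 + 2 * n * b)"
    using a b assms by (intro divide_left_mono mult_pos_pos add_pos_pos) auto
  thus ?thesis
    using assms by (simp add: max_ratio a_def[symmetric] b_def[symmetric] mult_ac)
qed

section \<open>Contraction of the expected potential\<close>

context random_matching_execution
begin

section \<open>Measurability and conditioning\<close>

lemma pred_G [measurable]: "Measurable.pred P (\<lambda>\<omega>. Q (G t \<omega>))"
  by (rule measurable_compose[OF measurable_G]) simp

lemma pred_M [measurable]: "Measurable.pred P (\<lambda>\<omega>. Q (M t \<omega>))"
  by (rule measurable_compose[OF measurable_M]) simp

lemma pred_\<Gamma> [measurable]: "Measurable.pred P (\<lambda>\<omega>. Q (\<Gamma> t \<omega>))"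
  by (rule measurable_compose[OF measurable_\<Gamma>]) simp

lemma prob_split_G:
  assumes [measurable]: "Measurable.pred P Q"
  shows "\<P>(\<omega> in P. Q \<omega>) = (\<Sum>E\<in>UNIV. \<P>(\<omega> in P. G t \<omega> = E \<and> Q \<omega>))"
  by (rule prob_sum) auto

text \<open>The laws of the process are given as conditional probabilities on events of positive
  probability. The product form also covers null events and can be summed.\<close>

lemma cond_prob_mult:
  assumes [measurable]: "Measurable.pred P Q" "Measurable.pred P R"
    and "\<P>(\<omega> in P. R \<omega>) > 0 \<Longrightarrow> x \<le> \<P>(\<omega> in P. Q \<omega> \<bar> R \<omega>)"
  shows "x * \<P>(\<omega> in P. R \<omega>) \<le> \<P>(\<omega> in P. Q \<omega> \<and> R \<omega>)"
proof (cases "\<P>(\<omega> in P. R \<omega>) > 0")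
  case True
  thus ?thesis using assms(3) by (simp add: cond_prob_def field_simps)
next
  case False
  hence "\<P>(\<omega> in P. R \<omega>) = 0" using measure_nonneg[of P] by (meson antisym_conv2 not_le)
  thus ?thesis by simp
qed

section \<open>Probability that a given pair is matched\<close>

text \<open>Given \<open>G t = E\<close> and the configuration at time \<open>Suc t\<close>, the
  next graph is a fresh Markov step from \<open>E\<close>; given that graph and the configuration,
  fairness bounds the matching probability. Averaging over the next graph brings in the expected
  inverse degree. The time is \<open>Suc t\<close> because the initial graph is arbitrary and may
  lack the edge.\<close>

lemma prob_matched_ge:
  assumes fair: "fair P G M \<Gamma> F" and F: "0 < F" and uv: "u \<noteq> v"
    and pq: "0 < p" "p \<le> 1" "0 \<le> q" "q < 1"
  shows "F * (min p (1 - q) / (1 + 2 * real CARD('v) * max p (1 - q))) * \<P>(\<omega> in P. \<Gamma> (Suc t) \<omega> = \<gamma>)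
    \<le> \<P>(\<omega> in P. {u, v} \<in> M (Suc t) \<omega> \<and> \<Gamma> (Suc t) \<omega> = \<gamma>)"
proof -
  define c where "c = min p (1 - q) / (1 + 2 * real CARD('v) * max p (1 - q))"
  define w where "w = (\<lambda>E. F / real (max (deg E u) (deg E v)))"
  \<comment> \<open>Expresses the event that the current configuration is \<gamma> as an event about
    the history, the form required by \<open>edge_markovian\<close> and \<open>fair\<close>.\<close>
  let ?A = "{h :: 'v history. snd h = \<gamma>}"
  have hist: "snd (history G M \<Gamma> t \<omega>) = \<Gamma> t \<omega>" for t \<omega>
    by (simp add: history_def)
  have w: "w E \<ge> 0" for E using F by (simp add: w_def)
  have step: "\<P>(\<omega> in P. G (Suc t) \<omega> = E' \<and> G t \<omega> = E \<and> \<Gamma> (Suc t) \<omega> = \<gamma>)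
      \<ge> pmf (edge_markov_step p q E) E' * \<P>(\<omega> in P. G t \<omega> = E \<and> \<Gamma> (Suc t) \<omega> = \<gamma>)" for E E'
    by (rule cond_prob_mult) (use edge_markovian[of t E ?A E'] in \<open>simp_all add: hist\<close>)
  have now: "w E' * \<P>(\<omega> in P. G (Suc t) \<omega> = E' \<and> \<Gamma> (Suc t) \<omega> = \<gamma>)
      \<le> \<P>(\<omega> in P. {u, v} \<in> M (Suc t) \<omega> \<and> G (Suc t) \<omega> = E' \<and> \<Gamma> (Suc t) \<omega> = \<gamma>)"
    if "{u, v} \<in> E'" for E'
  proof (cases "simple_graph E'")
    case True
    show ?thesis
      by (rule cond_prob_mult)
        (use fair[unfolded fair_def, rule_format, OF True that, of "Suc t" ?A] in
          \<open>simp_all add: hist w_def\<close>)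
  next
    case False
    have "AE \<omega> in P. \<not> (G (Suc t) \<omega> = E' \<and> \<Gamma> (Suc t) \<omega> = \<gamma>)"
      using graph[of "Suc t"] by eventually_elim (use False in auto)
    hence "\<P>(\<omega> in P. G (Suc t) \<omega> = E' \<and> \<Gamma> (Suc t) \<omega> = \<gamma>) = 0"
      by (subst prob_Collect_eq_0) auto
    thus ?thesis by simp
  qed
  have "F * c * \<P>(\<omega> in P. \<Gamma> (Suc t) \<omega> = \<gamma>)
      = (\<Sum>E\<in>UNIV. F * c * \<P>(\<omega> in P. G t \<omega> = E \<and> \<Gamma> (Suc t) \<omega> = \<gamma>))"
    by (subst prob_split_G[of _ t]) (auto simp: sum_distrib_left)
  \<comment> \<open>The estimate from \<open>expected_inverse_max_deg\<close> is uniform in the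
    previous graph \<open>E\<close>, whatever the law of \<open>G t\<close>.\<close>
  also have "\<dots> \<le> (\<Sum>E\<in>UNIV. (\<Sum>E'\<in>{E'. {u, v} \<in> E'}. w E' * pmf (edge_markov_step p q E) E')
      * \<P>(\<omega> in P. G t \<omega> = E \<and> \<Gamma> (Suc t) \<omega> = \<gamma>))"
  proof (intro sum_mono mult_right_mono)
    fix E :: "'v set set"
    have "F * c \<le> F * (\<Sum>E'\<in>{E'. {u, v} \<in> E'}.
        pmf (edge_markov_step p q E) E' / real (max (deg E' u) (deg E' v)))"
      unfolding c_def using F expected_inverse_max_deg[OF pq uv, of E]
      by (intro mult_left_mono) auto
    thus "F * c \<le> (\<Sum>E'\<in>{E'. {u, v} \<in> E'}. w E' * pmf (edge_markov_step p q E) E')"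
      by (simp add: w_def sum_distrib_left mult_ac)
  qed simp
  also have "\<dots> = (\<Sum>E'\<in>{E'. {u, v} \<in> E'}. w E' * (\<Sum>E\<in>UNIV. pmf (edge_markov_step p q E) E'
      * \<P>(\<omega> in P. G t \<omega> = E \<and> \<Gamma> (Suc t) \<omega> = \<gamma>)))"
    by (simp add: sum_distrib_right sum_distrib_left mult.assoc sum.swap[of _ UNIV])
  also have "\<dots> \<le> (\<Sum>E'\<in>{E'. {u, v} \<in> E'}. w E' * (\<Sum>E\<in>UNIV.
      \<P>(\<omega> in P. G t \<omega> = E \<and> G (Suc t) \<omega> = E' \<and> \<Gamma> (Suc t) \<omega> = \<gamma>)))"
    using step w by (intro sum_mono mult_left_mono) (auto simp: conj_ac)
  also have "\<dots> = (\<Sum>E'\<in>{E'. {u, v} \<in> E'}. w E' * \<P>(\<omega> in P. G (Suc t) \<omega> = E' \<and> \<Gamma> (Suc t) \<omega> = \<gamma>))"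
    by (subst prob_split_G[of "\<lambda>\<omega>. G (Suc t) \<omega> = _ \<and> \<Gamma> (Suc t) \<omega> = \<gamma>" t]) auto
  also have "\<dots> \<le> (\<Sum>E'\<in>{E'. {u, v} \<in> E'}.
      \<P>(\<omega> in P. G (Suc t) \<omega> = E' \<and> {u, v} \<in> M (Suc t) \<omega> \<and> \<Gamma> (Suc t) \<omega> = \<gamma>))"
    using now by (intro sum_mono) (auto simp: conj_ac)
  also have "\<dots> \<le> (\<Sum>E'\<in>UNIV.
      \<P>(\<omega> in P. G (Suc t) \<omega> = E' \<and> {u, v} \<in> M (Suc t) \<omega> \<and> \<Gamma> (Suc t) \<omega> = \<gamma>))"
    by (intro sum_mono2) auto
  also have "\<dots> = \<P>(\<omega> in P. {u, v} \<in> M (Suc t) \<omega> \<and> \<Gamma> (Suc t) \<omega> = \<gamma>)"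
    by (rule prob_split_G[symmetric]) simp
  finally show ?thesis by (simp add: c_def)
qed

section \<open>Almost sure one-step evolution\<close>

text \<open>The exceptional event is a countable union over triples of a matching and two
  configurations, each null by \<open>balancing\<close> with the trivial event
  \<open>UNIV\<close>.\<close>

lemma AE_balance_step: "AE \<omega> in P. \<Gamma> (Suc t) \<omega> \<in> set_pmf (balance_step (M t \<omega>) (\<Gamma> t \<omega>))"
proof -
  have "AE \<omega> in P. \<forall>\<gamma> \<gamma>'. \<forall>m\<in>UNIV. \<gamma>' \<notin> set_pmf (balance_step m \<gamma>) \<longrightarrow>
      \<not> (\<Gamma> (Suc t) \<omega> = \<gamma>' \<and> M t \<omega> = m \<and> \<Gamma> t \<omega> = \<gamma>)"
  proof (unfold AE_all_countable, intro allI AE_finite_allI finite)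
    fix \<gamma> \<gamma>' m
    show "AE \<omega> in P. \<gamma>' \<notin> set_pmf (balance_step m \<gamma>) \<longrightarrow>
      \<not> (\<Gamma> (Suc t) \<omega> = \<gamma>' \<and> M t \<omega> = m \<and> \<Gamma> t \<omega> = \<gamma>)"
    proof (cases "\<gamma>' \<in> set_pmf (balance_step m \<gamma>)")
      case False
      have "\<P>(\<omega> in P. \<Gamma> (Suc t) \<omega> = \<gamma>' \<and> M t \<omega> = m \<and> \<Gamma> t \<omega> = \<gamma>) = 0"
      proof (cases "\<P>(\<omega> in P. M t \<omega> = m \<and> \<Gamma> t \<omega> = \<gamma>) > 0")
        case True
        thus ?thesis using balancing[of t m \<gamma> UNIV \<gamma>'] False
          by (simp add: cond_prob_def set_pmf_iff)
      next
        case 2: False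
        have "\<P>(\<omega> in P. \<Gamma> (Suc t) \<omega> = \<gamma>' \<and> M t \<omega> = m \<and> \<Gamma> t \<omega> = \<gamma>)
            \<le> \<P>(\<omega> in P. M t \<omega> = m \<and> \<Gamma> t \<omega> = \<gamma>)"
          by (rule finite_measure_mono) auto
        thus ?thesis using 2 measure_nonneg[of P] by (meson antisym not_le order.trans)
      qed
      thus ?thesis using False by (simp add: prob_Collect_eq_0)
    qed simp
  qed
  thus ?thesis by eventually_elim auto
qed

text \<open>Summing indicators over all pairs, in place of summing over the random matching, lets
  the expectation be taken term by term.\<close>

lemma AE_step:
  "AE \<omega> in P. (\<Sum>v\<in>UNIV. \<Gamma> (Suc t) \<omega> v) = (\<Sum>v\<in>UNIV. \<Gamma> t \<omega> v) \<and>
     potential k (\<Gamma> (Suc t) \<omega>)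
       = potential k (\<Gamma> t \<omega>) - (\<Sum>e\<in>all_pairs. if e \<in> M t \<omega> then edge_gain k (\<Gamma> t \<omega>) e else 0)"
  using AE_balance_step[of t] graph[of t] matching[of t]
proof eventually_elim
  case (elim \<omega>)
  have "M t \<omega> \<subseteq> all_pairs" using elim by (auto simp: matching_in_def simple_graph_def)
  hence "all_pairs \<inter> {e. e \<in> M t \<omega>} = M t \<omega>" by auto
  thus ?case using set_balance_step[OF elim(2,3,1)] by (simp add: sum.If_cases)
qed

lemma AE_sum: "AE \<omega> in P. (\<Sum>v\<in>UNIV. \<Gamma> t \<omega> v) = (\<Sum>v\<in>UNIV. \<gamma>\<^sub>0 v)"
proof (induction t)
  case 0
  show ?case using initial_tokens by eventually_elim simp
next
  case (Suc t)
  show ?case using Suc AE_step[of t 0] by eventually_elim simp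
qed

text \<open>With conservation of tokens this confines the process almost surely to a finite set, on
  which expectations are finite sums.\<close>

lemma finite_configurations: "finite {\<gamma> :: 'v \<Rightarrow> nat. (\<Sum>v\<in>UNIV. \<gamma> v) = K}"
proof (rule finite_subset)
  show "{\<gamma> :: 'v \<Rightarrow> nat. (\<Sum>v\<in>UNIV. \<gamma> v) = K} \<subseteq> (UNIV \<rightarrow>\<^sub>E {..K})"
    by (auto intro!: member_le_sum)
  show "finite ((UNIV :: 'v set) \<rightarrow>\<^sub>E {..K})" by (intro finite_PiE) auto
qed

text \<open>Almost surely the integrand equals a finite combination of indicators, so integrability
  holds for every \<open>g\<close>. It serves for \<open>Q\<close> trivially true and for
  \<open>Q\<close> the event that a given pair is matched.\<close>

lemma expectation_configuration:
  fixes g :: "('v \<Rightarrow> nat) \<Rightarrow> real"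
  assumes [measurable]: "Measurable.pred P Q"
  defines "S \<equiv> {\<gamma>. (\<Sum>v\<in>UNIV. \<gamma> v) = (\<Sum>v\<in>UNIV. \<gamma>\<^sub>0 v)}"
  shows "integrable P (\<lambda>\<omega>. if Q \<omega> then g (\<Gamma> t \<omega>) else 0)"
    and "expectation (\<lambda>\<omega>. if Q \<omega> then g (\<Gamma> t \<omega>) else 0)
      = (\<Sum>\<gamma>\<in>S. g \<gamma> * \<P>(\<omega> in P. Q \<omega> \<and> \<Gamma> t \<omega> = \<gamma>))"
proof -
  let ?I = "\<lambda>\<gamma>. indicator {\<omega> \<in> space P. Q \<omega> \<and> \<Gamma> t \<omega> = \<gamma>} :: 'w \<Rightarrow> real"
  have S: "finite S" unfolding S_def by (rule finite_configurations)
  have [measurable]: "(\<lambda>\<omega>. g (\<Gamma> t \<omega>)) \<in> borel_measurable P"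
    by (rule measurable_compose[OF measurable_\<Gamma>]) simp
  have *: "AE \<omega> in P. (if Q \<omega> then g (\<Gamma> t \<omega>) else 0) = (\<Sum>\<gamma>\<in>S. g \<gamma> * ?I \<gamma> \<omega>)"
    using AE_sum[of t] AE_space
  proof eventually_elim
    case (elim \<omega>)
    have "(\<Sum>\<gamma>\<in>S. g \<gamma> * ?I \<gamma> \<omega>) = (\<Sum>\<gamma>\<in>S. if \<gamma> = \<Gamma> t \<omega> then (if Q \<omega> then g \<gamma> else 0) else 0)"
      using elim by (intro sum.cong) (auto simp: indicator_def)
    thus ?case using S elim by (simp add: S_def)
  qed
  have i: "integrable P (\<lambda>\<omega>. g \<gamma> * ?I \<gamma> \<omega>)" for \<gamma>
    by (intro integrable_mult_right integrable_real_indicator) (auto simp: emeasure_eq_measure)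
  show "integrable P (\<lambda>\<omega>. if Q \<omega> then g (\<Gamma> t \<omega>) else 0)"
    by (subst integrable_cong_AE[OF _ _ *]) (use i in auto)
  have "expectation (\<lambda>\<omega>. if Q \<omega> then g (\<Gamma> t \<omega>) else 0) = expectation (\<lambda>\<omega>. \<Sum>\<gamma>\<in>S. g \<gamma> * ?I \<gamma> \<omega>)"
    by (intro integral_cong_AE *) auto
  also have "\<dots> = (\<Sum>\<gamma>\<in>S. g \<gamma> * \<P>(\<omega> in P. Q \<omega> \<and> \<Gamma> t \<omega> = \<gamma>))"
    using i by (subst Bochner_Integration.integral_sum) auto
  finally show "expectation (\<lambda>\<omega>. if Q \<omega> then g (\<Gamma> t \<omega>) else 0)
      = (\<Sum>\<gamma>\<in>S. g \<gamma> * \<P>(\<omega> in P. Q \<omega> \<and> \<Gamma> t \<omega> = \<gamma>))" .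
qed

lemma integrable_potential: "integrable P (\<lambda>\<omega>. real_of_int (potential k (\<Gamma> t \<omega>)))"
  using expectation_configuration(1)[of "\<lambda>_. True"] by simp

section \<open>Decay of the expected potential\<close>

lemma expected_potential_Suc:
  "expectation (\<lambda>\<omega>. real_of_int (potential k (\<Gamma> (Suc t) \<omega>))) = expectation (\<lambda>\<omega>. real_of_int (potential k (\<Gamma> t \<omega>)))
    - (\<Sum>e\<in>all_pairs. expectation (\<lambda>\<omega>. if e \<in> M t \<omega> then real_of_int (edge_gain k (\<Gamma> t \<omega>) e) else 0))"
proof -
  have i: "integrable P (\<lambda>\<omega>. if e \<in> M t \<omega> then real_of_int (edge_gain k (\<Gamma> t \<omega>) e) else 0)" for e
    by (rule expectation_configuration(1)) simp
  have "expectation (\<lambda>\<omega>. real_of_int (potential k (\<Gamma> (Suc t) \<omega>)))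
      = expectation (\<lambda>\<omega>. real_of_int (potential k (\<Gamma> t \<omega>))
          - (\<Sum>e\<in>all_pairs. if e \<in> M t \<omega> then real_of_int (edge_gain k (\<Gamma> t \<omega>) e) else 0))"
  proof (rule integral_cong_AE)
    show "AE \<omega> in P. real_of_int (potential k (\<Gamma> (Suc t) \<omega>)) = real_of_int (potential k (\<Gamma> t \<omega>))
        - (\<Sum>e\<in>all_pairs. if e \<in> M t \<omega> then real_of_int (edge_gain k (\<Gamma> t \<omega>) e) else 0)"
      using AE_step[of t k]
      by eventually_elim (simp add: if_distrib[of real_of_int] cong: if_cong)
  qed (use i integrable_potential in \<open>auto intro!: borel_measurable_integrable\<close>)
  also have "\<dots> = expectation (\<lambda>\<omega>. real_of_int (potential k (\<Gamma> t \<omega>)))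
      - (\<Sum>e\<in>all_pairs. expectation (\<lambda>\<omega>. if e \<in> M t \<omega> then real_of_int (edge_gain k (\<Gamma> t \<omega>) e) else 0))"
    using i integrable_potential
    by (subst Bochner_Integration.integral_diff) (auto simp: Bochner_Integration.integral_sum)
  finally show ?thesis .
qed

lemma expected_potential_antimono:
  "expectation (\<lambda>\<omega>. real_of_int (potential k (\<Gamma> (Suc t) \<omega>))) \<le> expectation (\<lambda>\<omega>. real_of_int (potential k (\<Gamma> t \<omega>)))"
proof -
  have "0 \<le> (\<Sum>e\<in>all_pairs. expectation (\<lambda>\<omega>. if e \<in> M t \<omega> then real_of_int (edge_gain k (\<Gamma> t \<omega>) e) else 0))"
    by (intro sum_nonneg Bochner_Integration.integral_nonneg) (auto simp: edge_gain_nonneg)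
  thus ?thesis using expected_potential_Suc[of k t] by linarith
qed

text \<open>For each configuration, the matching bound replaces the event that a pair is matched by
  the weight \<beta> / n; this is legitimate termwise because edge gains are nonnegative. By
  \<open>potential_le_edge_gain\<close> the weighted gains amount to at least \<beta> / 32 times the
  potential.\<close>

lemma expected_potential_contracts:
  assumes matched: "\<And>u v \<gamma>. u \<noteq> v \<Longrightarrow> \<beta> / real CARD('v) * \<P>(\<omega> in P. \<Gamma> t \<omega> = \<gamma>)
      \<le> \<P>(\<omega> in P. {u, v} \<in> M t \<omega> \<and> \<Gamma> t \<omega> = \<gamma>)"
    and \<beta>: "0 \<le> \<beta>"
    and k: "2 * \<bar>int (\<Sum>v\<in>UNIV. \<gamma>\<^sub>0 v) - int CARD('v) * k\<bar> \<le> int CARD('v)"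
  shows "expectation (\<lambda>\<omega>. real_of_int (potential k (\<Gamma> (Suc t) \<omega>)))
    \<le> (1 - \<beta> / 32) * expectation (\<lambda>\<omega>. real_of_int (potential k (\<Gamma> t \<omega>)))"
proof -
  define S where "S = {\<gamma> :: 'v \<Rightarrow> nat. (\<Sum>v\<in>UNIV. \<gamma> v) = (\<Sum>v\<in>UNIV. \<gamma>\<^sub>0 v)}"
  define n where "n = real CARD('v)"
  have n: "n > 0" by (simp add: n_def)
  have "\<beta> / 32 * expectation (\<lambda>\<omega>. real_of_int (potential k (\<Gamma> t \<omega>)))
      = (\<Sum>\<gamma>\<in>S. \<beta> / 32 * real_of_int (potential k \<gamma>) * \<P>(\<omega> in P. \<Gamma> t \<omega> = \<gamma>))"
    using expectation_configuration(2)[of "\<lambda>_. True" "\<lambda>\<gamma>. real_of_int (potential k \<gamma>)" t]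
    by (simp add: S_def sum_distrib_left mult.assoc)
  also have "\<dots> \<le> (\<Sum>\<gamma>\<in>S. (\<Sum>e\<in>all_pairs. real_of_int (edge_gain k \<gamma> e))
      * (\<beta> / n * \<P>(\<omega> in P. \<Gamma> t \<omega> = \<gamma>)))"
  proof (rule sum_mono)
    fix \<gamma> assume "\<gamma> \<in> S"
    hence "int CARD('v) * potential k \<gamma> \<le> 32 * (\<Sum>e\<in>all_pairs. edge_gain k \<gamma> e)"
      using k by (intro potential_le_edge_gain) (simp add: S_def)
    hence "real_of_int (int CARD('v) * potential k \<gamma>)
        \<le> real_of_int (32 * (\<Sum>e\<in>all_pairs. edge_gain k \<gamma> e))"
      by (rule of_int_le_iff[THEN iffD2])
    hence "n * potential k \<gamma> \<le> 32 * (\<Sum>e\<in>all_pairs. real_of_int (edge_gain k \<gamma> e))"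
      by (simp add: n_def)
    hence "\<beta> / (32 * n) * \<P>(\<omega> in P. \<Gamma> t \<omega> = \<gamma>) * (n * potential k \<gamma>)
        \<le> \<beta> / (32 * n) * \<P>(\<omega> in P. \<Gamma> t \<omega> = \<gamma>) * (32 * (\<Sum>e\<in>all_pairs. real_of_int (edge_gain k \<gamma> e)))"
      using \<beta> n by (intro mult_left_mono) auto
    thus "\<beta> / 32 * real_of_int (potential k \<gamma>) * \<P>(\<omega> in P. \<Gamma> t \<omega> = \<gamma>)
        \<le> (\<Sum>e\<in>all_pairs. real_of_int (edge_gain k \<gamma> e)) * (\<beta> / n * \<P>(\<omega> in P. \<Gamma> t \<omega> = \<gamma>))"
      using n by (simp add: mult_ac)
  qed
  also have "\<dots> = (\<Sum>e\<in>all_pairs. \<Sum>\<gamma>\<in>S. real_of_int (edge_gain k \<gamma> e)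
      * (\<beta> / n * \<P>(\<omega> in P. \<Gamma> t \<omega> = \<gamma>)))"
    unfolding sum_distrib_right by (rule sum.swap)
  also have "\<dots> \<le> (\<Sum>e\<in>all_pairs. \<Sum>\<gamma>\<in>S. real_of_int (edge_gain k \<gamma> e)
      * \<P>(\<omega> in P. e \<in> M t \<omega> \<and> \<Gamma> t \<omega> = \<gamma>))"
  proof (intro sum_mono mult_left_mono)
    fix e :: "'v set" and \<gamma> assume e: "e \<in> all_pairs"
    thus "\<beta> / n * \<P>(\<omega> in P. \<Gamma> t \<omega> = \<gamma>) \<le> \<P>(\<omega> in P. e \<in> M t \<omega> \<and> \<Gamma> t \<omega> = \<gamma>)"
      using matched by (auto simp: n_def all_pairs_def card_2_iff)
    show "0 \<le> real_of_int (edge_gain k \<gamma> e)" using edge_gain_nonneg[OF e] by simp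
  qed
  also have "\<dots> = (\<Sum>e\<in>all_pairs. expectation (\<lambda>\<omega>. if e \<in> M t \<omega> then real_of_int (edge_gain k (\<Gamma> t \<omega>) e) else 0))"
  proof (rule sum.cong[OF refl])
    fix e :: "'v set"
    show "(\<Sum>\<gamma>\<in>S. real_of_int (edge_gain k \<gamma> e) * \<P>(\<omega> in P. e \<in> M t \<omega> \<and> \<Gamma> t \<omega> = \<gamma>))
        = expectation (\<lambda>\<omega>. if e \<in> M t \<omega> then real_of_int (edge_gain k (\<Gamma> t \<omega>) e) else 0)"
      using expectation_configuration(2)[of "\<lambda>\<omega>. e \<in> M t \<omega>" "\<lambda>\<gamma>. real_of_int (edge_gain k \<gamma> e)" t]
      by (simp add: S_def if_distrib[of real_of_int] cong: if_cong)
  qed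
  finally show ?thesis using expected_potential_Suc[of k t] by (simp add: algebra_simps)
qed

text \<open>An unbalanced configuration has a positive integer potential, so Markov's inequality
  applies with threshold 1. The exponent is one less than the time because the first step is only
  known not to increase the expectation.\<close>

lemma prob_not_balanced_le:
  assumes matched: "\<And>u v \<gamma> t. u \<noteq> v \<Longrightarrow> \<beta> / real CARD('v) * \<P>(\<omega> in P. \<Gamma> (Suc t) \<omega> = \<gamma>)
      \<le> \<P>(\<omega> in P. {u, v} \<in> M (Suc t) \<omega> \<and> \<Gamma> (Suc t) \<omega> = \<gamma>)"
    and \<beta>: "0 \<le> \<beta>" "\<beta> \<le> 32"
    and k: "2 * \<bar>int (\<Sum>v\<in>UNIV. \<gamma>\<^sub>0 v) - int CARD('v) * k\<bar> \<le> int CARD('v)"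
  shows "\<P>(\<omega> in P. \<exists>v. int (\<Gamma> (Suc t) \<omega> v) \<notin> {k - 1, k, k + 1})
    \<le> (1 - \<beta> / 32) ^ t * potential k \<gamma>\<^sub>0"
proof -
  let ?\<Phi> = "\<lambda>t. expectation (\<lambda>\<omega>. real_of_int (potential k (\<Gamma> t \<omega>)))"
  have \<Phi>0: "?\<Phi> 0 = potential k \<gamma>\<^sub>0"
  proof -
    have "?\<Phi> 0 = expectation (\<lambda>_. real_of_int (potential k \<gamma>\<^sub>0))"
      using initial_tokens integrable_potential[of k 0]
      by (intro integral_cong_AE) (auto intro: borel_measurable_integrable)
    thus ?thesis by (simp add: prob_space)
  qed
  have \<Phi>: "?\<Phi> (Suc t) \<le> (1 - \<beta> / 32) ^ t * potential k \<gamma>\<^sub>0" for t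
  proof (induction t)
    case 0
    show ?case using expected_potential_antimono[of k 0] \<Phi>0 by simp
  next
    case (Suc t)
    have "?\<Phi> (Suc (Suc t)) \<le> (1 - \<beta> / 32) * ?\<Phi> (Suc t)"
      by (rule expected_potential_contracts[OF matched \<beta>(1) k])
    also have "\<dots> \<le> (1 - \<beta> / 32) * ((1 - \<beta> / 32) ^ t * potential k \<gamma>\<^sub>0)"
      using Suc \<beta> by (intro mult_left_mono) auto
    finally show ?case by (simp add: mult.assoc)
  qed
  have "potential k \<gamma> \<ge> 1" if "int (\<gamma> v) \<notin> {k - 1, k, k + 1}" for \<gamma> :: "'v \<Rightarrow> nat" and v
  proof -
    have "excess (int (\<gamma> v) - k) \<noteq> 0" using that excess_eq_0[of "int (\<gamma> v) - k"] by auto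
    moreover have "excess (int (\<gamma> v) - k) \<le> potential k \<gamma>"
      unfolding potential_def by (rule member_le_sum) (auto simp: excess_nonneg)
    ultimately show ?thesis using excess_nonneg[of "int (\<gamma> v) - k"] by linarith
  qed
  hence "\<P>(\<omega> in P. \<exists>v. int (\<Gamma> (Suc t) \<omega> v) \<notin> {k - 1, k, k + 1})
      \<le> \<P>(\<omega> in P. 1 \<le> real_of_int (potential k (\<Gamma> (Suc t) \<omega>)))"
    by (intro finite_measure_mono) auto
  also have "\<dots> \<le> ?\<Phi> (Suc t) / 1"
    by (rule integral_Markov_inequality_measure[OF integrable_potential, where A = "{}"])
      (auto simp: potential_nonneg)
  finally show ?thesis using \<Phi>[of t] by simp
qed

end

section \<open>Balancing time and choice of constants\<close>

text \<open>A nonempty set of extended naturals attains its infimum, and the empty one has infimum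
  \<infinity>, which exceeds every real bound.\<close>

lemma T_bal_le_iff:
  "ereal_of_enat (T_bal \<mu> \<Gamma> \<omega>) \<le> ereal x \<longleftrightarrow> (\<exists>t. real t \<le> x \<and> balanced \<mu> (\<Gamma> t \<omega>))"
proof
  define A where "A = {enat t | t. balanced \<mu> (\<Gamma> t \<omega>)}"
  assume le: "ereal_of_enat (T_bal \<mu> \<Gamma> \<omega>) \<le> ereal x"
  have "T_bal \<mu> \<Gamma> \<omega> = \<infinity>" if "A = {}"
    using that by (simp add: T_bal_def A_def[symmetric] Inf_enat_def)
  with le have "A \<noteq> {}" by auto
  hence "T_bal \<mu> \<Gamma> \<omega> \<in> A"
    unfolding T_bal_def A_def[symmetric] Inf_enat_def by (auto intro: LeastI)
  then obtain t where "T_bal \<mu> \<Gamma> \<omega> = enat t" "balanced \<mu> (\<Gamma> t \<omega>)" by (auto simp: A_def)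
  thus "\<exists>t. real t \<le> x \<and> balanced \<mu> (\<Gamma> t \<omega>)" using le by auto
next
  assume "\<exists>t. real t \<le> x \<and> balanced \<mu> (\<Gamma> t \<omega>)"
  then obtain t where t: "real t \<le> x" "balanced \<mu> (\<Gamma> t \<omega>)" by auto
  have "T_bal \<mu> \<Gamma> \<omega> \<le> enat t" unfolding T_bal_def using t by (intro Inf_lower) auto
  hence "ereal_of_enat (T_bal \<mu> \<Gamma> \<omega>) \<le> ereal_of_enat (enat t)" by (simp only: ereal_of_enat_le_iff)
  also have "\<dots> \<le> ereal x" using t by simp
  finally show "ereal_of_enat (T_bal \<mu> \<Gamma> \<omega>) \<le> ereal x" .
qed

text \<open>Rounding moves the mean by at most 1/2, the tolerance allowed by
  \<open>drift_bound\<close>. The mean lies between two integers, the least and the largest load,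
  and so does its rounding.\<close>

lemma rounded_mean:
  fixes \<gamma> :: "'v::finite \<Rightarrow> nat"
  defines "k \<equiv> round_half_down (mean_load \<gamma>)"
  shows "2 * \<bar>int (\<Sum>v\<in>UNIV. \<gamma> v) - int CARD('v) * k\<bar> \<le> int CARD('v)"
    and "\<bar>int (\<gamma> v) - k\<bar> \<le> int (discrepancy \<gamma>)"
proof -
  define n where "n = real CARD('v)"
  define \<mu> where "\<mu> = mean_load \<gamma>"
  have n: "n > 0" by (simp add: n_def)
  have k: "\<mu> - 1 / 2 \<le> real_of_int k" "real_of_int k < \<mu> + 1 / 2"
    unfolding k_def round_half_down_def \<mu>_def by linarith+
  have sum: "real (\<Sum>v\<in>UNIV. \<gamma> v) = n * \<mu>"
    by (simp add: \<mu>_def mean_load_def n_def)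
  have "\<bar>\<mu> - real_of_int k\<bar> \<le> 1 / 2" using k by linarith
  hence "2 * (n * \<bar>\<mu> - real_of_int k\<bar>) \<le> 2 * (n * (1 / 2))"
    using n by (intro mult_left_mono) auto
  also have "n * \<bar>\<mu> - real_of_int k\<bar> = \<bar>n * \<mu> - n * real_of_int k\<bar>"
    using n by (simp add: abs_mult flip: right_diff_distrib)
  finally have "real_of_int (2 * \<bar>int (\<Sum>v\<in>UNIV. \<gamma> v) - int CARD('v) * k\<bar>) \<le> real_of_int (int CARD('v))"
    using sum by (simp add: n_def)
  thus "2 * \<bar>int (\<Sum>v\<in>UNIV. \<gamma> v) - int CARD('v) * k\<bar> \<le> int CARD('v)"
    by (simp only: of_int_le_iff)
  define a b where "a = Min (range \<gamma>)" and "b = Max (range \<gamma>)"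
  have ab: "a \<le> \<gamma> v" "\<gamma> v \<le> b" for v by (simp_all add: a_def b_def)
  have "n * real a \<le> real (\<Sum>v\<in>UNIV. \<gamma> v)"
    using sum_bounded_below[of UNIV "real a" "\<lambda>v. real (\<gamma> v)"] ab by (simp add: n_def)
  hence "real a \<le> \<mu>" unfolding sum using n by simp
  moreover have "real (\<Sum>v\<in>UNIV. \<gamma> v) \<le> n * real b"
    using sum_bounded_above[of UNIV "\<lambda>v. real (\<gamma> v)" "real b"] ab by (simp add: n_def)
  hence "\<mu> \<le> real b" unfolding sum using n by simp
  ultimately have "int a \<le> k" "k \<le> int b" using k by linarith+
  thus "\<bar>int (\<gamma> v) - k\<bar> \<le> int (discrepancy \<gamma>)"
    using ab[of v] unfolding discrepancy_def a_def[symmetric] b_def[symmetric] by linarith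
qed

lemma initial_potential_le:
  fixes \<gamma> :: "'v::finite \<Rightarrow> nat"
  shows "real_of_int (potential (round_half_down (mean_load \<gamma>)) \<gamma>)
    \<le> real CARD('v) * (real (discrepancy \<gamma>))\<^sup>2"
proof -
  have "potential (round_half_down (mean_load \<gamma>)) \<gamma> \<le> (\<Sum>v\<in>(UNIV :: 'v set). (int (discrepancy \<gamma>))\<^sup>2)"
    unfolding potential_def by (intro sum_mono excess_mono rounded_mean)
  hence "real_of_int (potential (round_half_down (mean_load \<gamma>)) \<gamma>)
      \<le> real_of_int (\<Sum>v\<in>(UNIV :: 'v set). (int (discrepancy \<gamma>))\<^sup>2)"
    by (rule of_int_le_iff[THEN iffD2])
  thus ?thesis by simp
qed

text \<open>As (1 - \<beta> / 32)^t <= exp(- \<beta> t / 32), it suffices that \<beta> t >= 64 L.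
  Rounding \<open>x\<close> down and the shift by one step cost at most 2 \<beta> <= L, which the
  constant 91 leaves room for.\<close>

lemma contraction_time:
  fixes \<beta> L x :: real
  assumes \<beta>: "0 < \<beta>" "\<beta> \<le> 1 / 2" and L: "1 \<le> L" and x: "91 * L / \<beta> \<le> x"
  obtains t :: nat where "real (Suc t) \<le> x" "(1 - \<beta> / 32) ^ t \<le> exp (- (2 * L))"
proof -
  \<comment> \<open>\<open>Suc t\<close> is the floor of \<open>x\<close>; the subtraction is
    genuine since \<open>x\<close> is at least 2.\<close>
  define t where "t = nat \<lfloor>x\<rfloor> - 1"
  have x\<beta>: "91 * L \<le> \<beta> * x" using x \<beta> by (simp add: field_simps)
  have "91 * L * 2 \<le> 91 * L / \<beta>" using \<beta> L by (simp add: field_simps)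
  hence x2: "2 \<le> x" using x L by linarith
  have t: "real (Suc t) \<le> x" "x - 2 \<le> real t" using x2 unfolding t_def by linarith+
  have "\<beta> * (x - 2) \<le> \<beta> * real t" using t \<beta> by (intro mult_left_mono) auto
  hence "64 * L \<le> \<beta> * real t" using x\<beta> \<beta> L by (simp add: algebra_simps)
  hence e: "real t * (- \<beta> / 32) \<le> - (2 * L)" by (simp add: mult.commute)
  have "1 - \<beta> / 32 \<le> exp (- \<beta> / 32)" using exp_ge_add_one_self[of "- \<beta> / 32"] by simp
  hence "(1 - \<beta> / 32) ^ t \<le> exp (- \<beta> / 32) ^ t" using \<beta> by (intro power_mono) auto
  also have "\<dots> = exp (real t * (- \<beta> / 32))" by (rule exp_of_nat_mult[symmetric])
  also have "\<dots> \<le> exp (- (2 * L))" using e by simp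
  finally show ?thesis using that t(1) by blast
qed

theorem theorem3:
  fixes P :: "'w measure"
    and G M :: "nat \<Rightarrow> 'w \<Rightarrow> 'v::finite set set"
    and \<Gamma> :: "nat \<Rightarrow> 'w \<Rightarrow> 'v \<Rightarrow> nat"
    and \<gamma>\<^sub>0 :: "'v \<Rightarrow> nat"
    and n :: nat
    and \<theta> p q F c r \<epsilon> :: real
  assumes "\<theta> > 0"
    and "n = CARD('v)"
    and "0 < p" and "p \<le> 1"
    and "0 \<le> q" and "q < 1"
    and "max p (1 - q) \<ge> \<theta> / real n"
    and "random_matching_execution P p q G M \<Gamma> \<gamma>\<^sub>0"
    and "discrepancy \<gamma>\<^sub>0 \<ge> 1"
    and "0 < F" and "F \<le> 1"
    and "fair P G M \<Gamma> F"
    and "c = 91 / c_star \<theta>"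
    and "r = max (p / (1 - q)) ((1 - q) / p)"
    and "0 < \<epsilon>" and "\<epsilon> < 1 / 4"
  shows "c > 0 \<and> r \<ge> 1 \<and>
    \<P>(\<omega> in P. ereal_of_enat (T_bal (mean_load \<gamma>\<^sub>0) \<Gamma> \<omega>)
        \<le> ereal (c * r * ln (real (discrepancy \<gamma>\<^sub>0) * real n / \<epsilon>) / F))
      \<ge> 1 - \<epsilon>"
proof -
  interpret random_matching_execution P p q G M \<Gamma> \<gamma>\<^sub>0 by fact
  define \<Delta> where "\<Delta> = real (discrepancy \<gamma>\<^sub>0)"
  define L where "L = ln (\<Delta> * real n / \<epsilon>)"
  define \<beta> where "\<beta> = F / (r * (2 + 1 / \<theta>))"
  define k where "k = round_half_down (mean_load \<gamma>\<^sub>0)"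
  define x where "x = c * r * L / F"
  have n: "real n \<ge> 1" using assms(2) by (simp add: Suc_leI)
  have \<Delta>: "\<Delta> \<ge> 1" using assms(9) by (simp add: \<Delta>_def)
  have r: "r \<ge> 1" using assms(3,6,14) max_ratio[of p "1 - q"] by (simp add: le_divide_eq)
  have s: "2 \<le> 2 + 1 / \<theta>" using assms(1) by simp
  define y where "y = 1 - exp (- \<theta> / 3)"
  have y: "0 < y" "y \<le> 1" using assms(1) by (auto simp: y_def)
  have c_eq: "c = 91 * (2 + 1 / \<theta>) / y\<^sup>2"
    using assms(13) by (simp add: c_star_def y_def)
  have c: "c > 0"
    unfolding c_eq using s y by (intro divide_pos_pos mult_pos_pos zero_less_power) linarith+
  have "1 * 2 \<le> r * (2 + 1 / \<theta>)" using r s by (intro mult_mono) auto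
  hence \<beta>: "0 < \<beta>" "\<beta> \<le> 1 / 2"
    using assms(10,11) by (auto simp: \<beta>_def divide_simps)
  have "1 * 1 \<le> \<Delta> * real n" using \<Delta> n by (intro mult_mono) auto
  hence \<Delta>n: "1 / \<epsilon> \<le> \<Delta> * real n / \<epsilon>" using assms(15) by (intro divide_right_mono) auto
  \<comment> \<open>The bound on \<epsilon> makes the argument of the logarithm at least e, hence L
    >= 1 as \<open>contraction_time\<close> requires.\<close>
  have "3 \<le> 1 / \<epsilon>" using assms(15,16) by (simp add: le_divide_eq)
  hence "exp 1 \<le> 1 / \<epsilon>" using exp_le by linarith
  with \<Delta>n have e: "exp 1 \<le> \<Delta> * real n / \<epsilon>" by linarith
  hence pos: "0 < \<Delta> * real n / \<epsilon>" using exp_gt_zero[of "1::real"] by linarith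
  hence L: "1 \<le> L" using e by (simp add: L_def ln_ge_iff)
  \<comment> \<open>The numerator \<open>y\<^sup>2\<close> of \<open>c_star\<close> is at most 1, so
    the time allowed by \<open>c\<close> is no shorter than 91 L / \<beta>.\<close>
  have "91 * L / \<beta> \<le> 91 * L / \<beta> / y\<^sup>2"
    using y L \<beta> by (simp add: le_divide_eq power_le_one mult_left_le)
  also have "\<dots> = x"
  proof -
    have "91 * L / (F / (r * m)) / y\<^sup>2 = 91 * m / y\<^sup>2 * r * L / F" for m
      by (simp add: mult_ac)
    thus ?thesis unfolding x_def c_eq \<beta>_def .
  qed
  finally obtain t where t: "real (Suc t) \<le> x" "(1 - \<beta> / 32) ^ t \<le> exp (- (2 * L))"
    using contraction_time[OF \<beta> L] by blast
  have matched: "\<beta> / real CARD('v) * \<P>(\<omega> in P. \<Gamma> (Suc t) \<omega> = \<gamma>)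
      \<le> \<P>(\<omega> in P. {u, v} \<in> M (Suc t) \<omega> \<and> \<Gamma> (Suc t) \<omega> = \<gamma>)" if "u \<noteq> v" for u v \<gamma> t
  proof -
    have "1 / (r * (2 + 1 / \<theta>)) / real n \<le> min p (1 - q) / (1 + 2 * real n * max p (1 - q))"
      unfolding assms(14) using assms n by (intro matched_rate) auto
    hence "F * (1 / (r * (2 + 1 / \<theta>)) / real n)
        \<le> F * (min p (1 - q) / (1 + 2 * real n * max p (1 - q)))"
      using assms(10) by (intro mult_left_mono) auto
    hence "\<beta> / real CARD('v) \<le> F * (min p (1 - q) / (1 + 2 * real CARD('v) * max p (1 - q)))"
      by (simp add: \<beta>_def assms(2))
    hence "\<beta> / real CARD('v) * \<P>(\<omega> in P. \<Gamma> (Suc t) \<omega> = \<gamma>)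
        \<le> F * (min p (1 - q) / (1 + 2 * real CARD('v) * max p (1 - q))) * \<P>(\<omega> in P. \<Gamma> (Suc t) \<omega> = \<gamma>)"
      by (rule mult_right_mono) simp
    also have "\<dots> \<le> \<P>(\<omega> in P. {u, v} \<in> M (Suc t) \<omega> \<and> \<Gamma> (Suc t) \<omega> = \<gamma>)"
      by (rule prob_matched_ge) (use assms that in auto)
    finally show ?thesis .
  qed
  have "\<P>(\<omega> in P. \<exists>v. int (\<Gamma> (Suc t) \<omega> v) \<notin> {k - 1, k, k + 1})
      \<le> (1 - \<beta> / 32) ^ t * potential k \<gamma>\<^sub>0"
    using \<beta> unfolding k_def by (intro prob_not_balanced_le matched rounded_mean) auto
  also have "\<dots> \<le> exp (- (2 * L)) * (real n * \<Delta>\<^sup>2)"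
    using t(2) initial_potential_le[of \<gamma>\<^sub>0] potential_nonneg[of k \<gamma>\<^sub>0]
    by (intro mult_mono) (auto simp: k_def \<Delta>_def assms(2))
  \<comment> \<open>The decay exp(-2L) is the square of \<epsilon> / (\<Delta> n), which cancels the
    \<Delta>^2 of the initial potential.\<close>
  also have "\<dots> = \<epsilon>\<^sup>2 / real n"
  proof -
    have "exp (2 * L) = (\<Delta> * real n / \<epsilon>)\<^sup>2"
      using pos by (simp add: L_def exp_double)
    thus ?thesis using \<Delta> n assms(15) by (simp add: exp_minus field_simps power2_eq_square)
  qed
  also have "\<dots> \<le> \<epsilon>"
  proof -
    have "\<epsilon> * \<epsilon> \<le> \<epsilon> * real n" using n assms(15,16) by (intro mult_left_mono) auto
    thus ?thesis using n by (simp add: divide_le_eq power2_eq_square)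
  qed
  finally have fail: "\<P>(\<omega> in P. \<exists>v. int (\<Gamma> (Suc t) \<omega> v) \<notin> {k - 1, k, k + 1}) \<le> \<epsilon>" .
  have "1 - \<epsilon> \<le> 1 - \<P>(\<omega> in P. \<exists>v. int (\<Gamma> (Suc t) \<omega> v) \<notin> {k - 1, k, k + 1})"
    using fail by simp
  also have "\<dots> = \<P>(\<omega> in P. balanced (mean_load \<gamma>\<^sub>0) (\<Gamma> (Suc t) \<omega>))"
    by (subst prob_neg[symmetric]) (auto simp: balanced_def k_def)
  also have "\<dots> \<le> \<P>(\<omega> in P. \<exists>t. real t \<le> x \<and> balanced (mean_load \<gamma>\<^sub>0) (\<Gamma> t \<omega>))"
    using t(1) by (intro finite_measure_mono) (auto intro!: exI[of _ "Suc t"])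
  finally show ?thesis
    using c r by (simp add: T_bal_le_iff x_def L_def \<Delta>_def)
qed

end
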